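(* Let $U,W$ be $\mathbb{F}_q$-subspaces of $V=\mathbb{F}_{q^n}^r$ with $\dim_{\mathbb{F}_q}U=\dim_{\mathbb{F}_q}W=rn-n$ and $L_U=L_W$. Let $F_U,F_W\in\mathbb{F}_{q^n}[x_0,\dots,x_{r-1}]$ be their determinantal polynomials. Then $F_W=\lambda F_U$ for some $\lambda\in\mathbb{F}_{q^n}^*$, and $w_{L_U}(P)=w_{L_W}(P)$ for every point $P\in L_U=L_W$.
   Context: $q$ a prime power, $n,r\ge2$. $L_U=\{\langle u\rangle_{\mathbb{F}_{q^n}}:u\in U\setminus\{0\}\}\subseteq\mathrm{PG}(r-1,q^n)$; weight $w_{L_U}(\langle v\rangle)=\dim_{\mathbb{F}_q}(\langle v\rangle_{\mathbb{F}_{q^n}}\cap U)$. Determinantal polynomial: for $u=(u_0,\dots,u_{r-1})$ let $\hat u=(u_0,\dots,u_{r-1},u_0^q,\dots,u_{r-1}^q,\dots,u_0^{q^{n-1}},\dots,u_{r-1}^{q^{n-1}})$; with an $\mathbb{F}_q$-basis $u_1,\dots,u_{rn-n}$ of $U$, $F_U$ is the determinant of the $rn\times rn$ matrix with rows $\hat u_1,\dots,\hat u_{rn-n}$ followed, for $i=0,\dots,n-1$, by the row with $x_0^{q^i},\dots,x_{r-1}^{q^i}$ in positions $ir,\dots,ir+r-1$ and zeros elsewhere. *)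

theory Defs
  imports "HOL-Library.Poly_Mapping" "Jordan_Normal_Form.Determinant"
begin

text \<open>Vectors of V = F_{q^n}^r are functions nat => 'a vanishing outside {0..<r}.
  F_q is the subfield {x. x^q = x} of the finite field 'a (of order q^n).\<close>

definition vecspace :: "nat \<Rightarrow> (nat \<Rightarrow> 'a::field) set" where
  "vecspace r = {v. \<forall>i\<ge>r. v i = 0}"

definition Fq :: "nat \<Rightarrow> 'a::field set" where
  "Fq q = {x. x ^ q = x}"

definition Fq_subspace :: "nat \<Rightarrow> nat \<Rightarrow> (nat \<Rightarrow> 'a::field) set \<Rightarrow> bool" where
  "Fq_subspace q r U \<longleftrightarrow> U \<subseteq> vecspace r \<and> (\<lambda>_. 0) \<in> U \<and>
     (\<forall>u\<in>U. \<forall>v\<in>U. (\<lambda>i. u i + v i) \<in> U) \<and>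
     (\<forall>c\<in>Fq q. \<forall>u\<in>U. (\<lambda>i. c * u i) \<in> U)"

definition Fq_lincomb :: "(nat \<Rightarrow> 'a::field) list \<Rightarrow> 'a list \<Rightarrow> (nat \<Rightarrow> 'a)" where
  "Fq_lincomb us cs = (\<lambda>i. \<Sum>k<length us. cs ! k * (us ! k) i)"

definition Fq_basis :: "nat \<Rightarrow> (nat \<Rightarrow> 'a::field) set \<Rightarrow> (nat \<Rightarrow> 'a) list \<Rightarrow> bool" where
  "Fq_basis q S us \<longleftrightarrow> set us \<subseteq> S \<and>
     (\<forall>cs. length cs = length us \<and> set cs \<subseteq> Fq q \<and> Fq_lincomb us cs = (\<lambda>_. 0)
        \<longrightarrow> (\<forall>c\<in>set cs. c = 0)) \<and>
     (\<forall>v\<in>S. \<exists>cs. length cs = length us \<and> set cs \<subseteq> Fq q \<and> v = Fq_lincomb us cs)"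

definition Fq_dim :: "nat \<Rightarrow> (nat \<Rightarrow> 'a::field) set \<Rightarrow> nat" where
  "Fq_dim q S = (THE k. \<exists>us. Fq_basis q S us \<and> length us = k)"

text \<open>The F_{q^n}-span of v, i.e. the projective point <v>.\<close>
definition Fspan :: "(nat \<Rightarrow> 'a::field) \<Rightarrow> (nat \<Rightarrow> 'a) set" where
  "Fspan v = {(\<lambda>i. c * v i) | c. True}"

definition linset :: "(nat \<Rightarrow> 'a::field) set \<Rightarrow> (nat \<Rightarrow> 'a) set set" where
  "linset U = {Fspan u | u. u \<in> U \<and> u \<noteq> (\<lambda>_. 0)}"

definition weight :: "nat \<Rightarrow> (nat \<Rightarrow> 'a::field) set \<Rightarrow> (nat \<Rightarrow> 'a) set \<Rightarrow> nat" where
  "weight q U P = Fq_dim q (P \<inter> U)"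

type_synonym 'a mpoly = "(nat \<Rightarrow>\<^sub>0 nat) \<Rightarrow>\<^sub>0 'a"

definition mconst :: "'a::comm_ring_1 \<Rightarrow> 'a mpoly" where
  "mconst c = Poly_Mapping.single 0 c"

definition mvar :: "nat \<Rightarrow> 'a::comm_ring_1 mpoly" where
  "mvar t = Poly_Mapping.single (Poly_Mapping.single t 1) 1"

text \<open>The rn x rn matrix: rows k < rn-n are hat(u_k), column j*r+i holding u_k(i)^(q^j);
  row rn-n+i has x_t^(q^i) in column i*r+t (t<r) and zeros elsewhere.\<close>
definition det_matrix :: "nat \<Rightarrow> nat \<Rightarrow> nat \<Rightarrow> (nat \<Rightarrow> 'a::comm_ring_1) list \<Rightarrow> 'a mpoly mat" where
  "det_matrix q n r us = mat (r*n) (r*n) (\<lambda>(a, b).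
     if a < r*n - n then mconst (((us ! a) (b mod r)) ^ (q ^ (b div r)))
     else (if b div r = a - (r*n - n) then mvar (b mod r) ^ (q ^ (a - (r*n - n))) else 0))"

definition det_poly :: "nat \<Rightarrow> nat \<Rightarrow> nat \<Rightarrow> (nat \<Rightarrow> 'a::comm_ring_1) list \<Rightarrow> 'a mpoly" where
  "det_poly q n r us = det (det_matrix q n r us)"

end

theory Submission
  imports Defs
begin

text \<open>Raising the entries of the matrix evaluated at \<open>v\<close> to the power \<open>q\<close> permutes its rows and
  columns, which multiplies the determinant by a sign depending only on \<open>n\<close> and \<open>r\<close>.
  So the nonzero values of \<open>F\<^sub>U\<^bsup>q-1\<^esup>\<close> on \<open>V\<close> all equal one and the same constant, and \<open>F\<^sub>U(v) = 0\<close> exactly if \<open>\<langle>v\<rangle>\<close> meets \<open>U\<close> nontrivially. Hence \<open>F\<^sub>U\<^bsup>q-1\<^esup>\<close> and \<open>F\<^sub>W\<^bsup>q-1\<^esup>\<close> agree as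
  functions on \<open>V\<close>; their degree in each variable is at most \<open>q\<^sup>n - 1\<close>, so they agree as polynomials,
  and \<open>F\<^sub>W\<close> is a scalar multiple of \<open>F\<^sub>U\<close>.

  For the weights, take \<open>z\<close> outside the linear set and restrict to the line through \<open>v\<close> and \<open>z\<close>.
  There \<open>U\<close> is the graph of an additive map \<open>g\<close>, and \<open>\<Prod>x\<noteq>0. (t - g(x)/x)\<close> is a polynomial of
  degree \<open>q\<^sup>n - 1\<close> in \<open>t\<close> whose values are the indicator of \<open>v + t z\<close> not lying on the linear set.
  It is therefore determined by the linear set, and its order of vanishing at \<open>0\<close> is
  \<open>q\<^sup>w - 1\<close> with \<open>w\<close> the weight of \<open>\<langle>v\<rangle>\<close>.\<close>

section \<open>Evaluation and reduced polynomials\<close>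

definition monom_eval :: "(nat \<Rightarrow> 'a::comm_ring_1) \<Rightarrow> (nat \<Rightarrow>\<^sub>0 nat) \<Rightarrow> 'a" where
  "monom_eval v m = (\<Prod>i\<in>Poly_Mapping.keys m. v i ^ Poly_Mapping.lookup m i)"

definition mpoly_eval :: "(nat \<Rightarrow> 'a::comm_ring_1) \<Rightarrow> 'a mpoly \<Rightarrow> 'a" where
  "mpoly_eval v f = (\<Sum>m\<in>Poly_Mapping.keys f. Poly_Mapping.lookup f m * monom_eval v m)"

lemma monom_eval_superset:
  assumes "finite A" "Poly_Mapping.keys m \<subseteq> A"
  shows "monom_eval v m = (\<Prod>i\<in>A. v i ^ Poly_Mapping.lookup m i)"
  unfolding monom_eval_def
  by (rule prod.mono_neutral_left) (use assms in \<open>auto simp: in_keys_iff\<close>)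

lemma monom_eval_zero [simp]: "monom_eval v 0 = 1"
  by (simp add: monom_eval_def)

lemma monom_eval_add: "monom_eval v (m + m') = monom_eval v m * monom_eval v m'"
proof -
  let ?A = "Poly_Mapping.keys m \<union> Poly_Mapping.keys m'"
  have "monom_eval v (m + m') = (\<Prod>i\<in>?A. v i ^ Poly_Mapping.lookup (m + m') i)"
    by (rule monom_eval_superset) (simp_all add: keys_add)
  also have "\<dots> = (\<Prod>i\<in>?A. v i ^ Poly_Mapping.lookup m i) * (\<Prod>i\<in>?A. v i ^ Poly_Mapping.lookup m' i)"
    by (simp add: lookup_add power_add prod.distrib)
  also have "\<dots> = monom_eval v m * monom_eval v m'"
    by (simp add: monom_eval_superset[of ?A])
  finally show ?thesis .
qed

lemma mpoly_eval_superset: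
  assumes "finite A" "Poly_Mapping.keys f \<subseteq> A"
  shows "mpoly_eval v f = (\<Sum>m\<in>A. Poly_Mapping.lookup f m * monom_eval v m)"
  unfolding mpoly_eval_def
  by (rule sum.mono_neutral_left) (use assms in \<open>auto simp: in_keys_iff\<close>)

lemma mpoly_eval_zero [simp]: "mpoly_eval v 0 = 0"
  by (simp add: mpoly_eval_def)

lemma mpoly_eval_single [simp]:
  "mpoly_eval v (Poly_Mapping.single m c) = c * monom_eval v m"
  by (subst mpoly_eval_superset[of "{m}"]) auto

lemma mpoly_eval_add: "mpoly_eval v (f + g) = mpoly_eval v f + mpoly_eval v g"
proof -
  let ?A = "Poly_Mapping.keys f \<union> Poly_Mapping.keys g"
  have "mpoly_eval v (f + g) = (\<Sum>m\<in>?A. Poly_Mapping.lookup (f + g) m * monom_eval v m)"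
    by (rule mpoly_eval_superset) (simp_all add: keys_add)
  also have "\<dots> = (\<Sum>m\<in>?A. Poly_Mapping.lookup f m * monom_eval v m) +
      (\<Sum>m\<in>?A. Poly_Mapping.lookup g m * monom_eval v m)"
    by (simp add: lookup_add distrib_right sum.distrib)
  also have "\<dots> = mpoly_eval v f + mpoly_eval v g"
    by (simp add: mpoly_eval_superset[of ?A])
  finally show ?thesis .
qed

text \<open>Updating a key outside the support adds a single term, so multiplicativity of evaluation
  can be proved term by term.\<close>

lemma mpoly_single_induct [case_names zero add]:
  fixes f :: "'a::comm_ring_1 mpoly"
  assumes "P 0" and "\<And>m c f. P f \<Longrightarrow> P (Poly_Mapping.single m c + f)"
  shows "P f"
proof (induction f rule: update_induct)
  case const
  show ?case by fact
next
  case (update f m c)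
  have "Poly_Mapping.update m c f = Poly_Mapping.single m c + f"
    using update(1)
    by (intro poly_mapping_eqI) (auto simp: lookup_update lookup_add lookup_single in_keys_iff when_def)
  with assms(2)[OF update(3)] show ?case by simp
qed

lemma mpoly_eval_mult: "mpoly_eval v (f * g) = mpoly_eval v f * mpoly_eval v g"
proof (induction f rule: mpoly_single_induct)
  case (add m c f)
  have single: "mpoly_eval v (Poly_Mapping.single m c * g) = c * monom_eval v m * mpoly_eval v g"
    by (induction g rule: mpoly_single_induct)
      (simp_all add: distrib_left mpoly_eval_add mult_single monom_eval_add)
  show ?case
    by (simp add: distrib_right mpoly_eval_add single add.IH)
qed simp

text \<open>As a ring homomorphism, evaluation commutes with determinants, so the values of
  \<open>det_poly\<close> are determinants over the field.\<close>

interpretation mpoly_eval: comm_ring_hom "mpoly_eval v" for v :: "nat \<Rightarrow> 'a::comm_ring_1"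
proof
  show "mpoly_eval v 1 = 1"
    unfolding single_one[symmetric] mpoly_eval_single by simp
qed (simp_all add: mpoly_eval_add mpoly_eval_mult)

lemma mpoly_eval_mconst [simp]: "mpoly_eval v (mconst c) = c"
  by (simp add: mconst_def)

lemma mpoly_eval_mvar [simp]: "mpoly_eval v (mvar t) = v t"
  by (simp add: mvar_def monom_eval_def)

section \<open>Degrees in a single variable\<close>

definition var_degree_le :: "nat \<Rightarrow> nat \<Rightarrow> 'a::comm_ring_1 mpoly \<Rightarrow> bool" where
  "var_degree_le t d f \<longleftrightarrow> (\<forall>m\<in>Poly_Mapping.keys f. Poly_Mapping.lookup m t \<le> d)"

lemma var_degree_le_zero [simp]: "var_degree_le t d 0"
  by (simp add: var_degree_le_def)

lemma var_degree_le_one [simp]: "var_degree_le t d 1"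
  by (simp add: var_degree_le_def)

lemma var_degree_le_mconst [simp]: "var_degree_le t d (mconst c)"
  by (simp add: var_degree_le_def mconst_def)

lemma var_degree_le_mvar: "d \<ge> (if s = t then 1 else 0) \<Longrightarrow> var_degree_le t d (mvar s)"
  by (auto simp: var_degree_le_def mvar_def lookup_single when_def)

lemma var_degree_le_uminus: "var_degree_le t d f \<Longrightarrow> var_degree_le t d (- f)"
  by (simp add: var_degree_le_def)

lemma var_degree_le_diff:
  "var_degree_le t d f \<Longrightarrow> var_degree_le t d g \<Longrightarrow> var_degree_le t d (f - g)"
  unfolding var_degree_le_def using keys_diff[of f g] by blast

lemma var_degree_le_sum:
  "(\<And>i. i \<in> I \<Longrightarrow> var_degree_le t d (f i)) \<Longrightarrow> var_degree_le t d (sum f I)"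
  unfolding var_degree_le_def using keys_sum[of f I] by blast

lemma var_degree_le_mult:
  assumes "var_degree_le t d f" "var_degree_le t e g"
  shows "var_degree_le t (d + e) (f * g)"
  unfolding var_degree_le_def
proof
  fix m assume "m \<in> Poly_Mapping.keys (f * g)"
  then obtain a b where "m = a + b" "a \<in> Poly_Mapping.keys f" "b \<in> Poly_Mapping.keys g"
    using keys_mult[of f g] by blast
  then show "Poly_Mapping.lookup m t \<le> d + e"
    using assms by (auto simp: var_degree_le_def lookup_add intro: add_mono)
qed

lemma var_degree_le_prod:
  "(\<And>i. i \<in> I \<Longrightarrow> var_degree_le t (d i) (f i)) \<Longrightarrow> var_degree_le t (sum d I) (prod f I)"
  by (induction I rule: infinite_finite_induct) (auto intro: var_degree_le_mult)

lemma var_degree_le_power: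
  "var_degree_le t d f \<Longrightarrow> var_degree_le t (N * d) (f ^ N)"
  by (induction N) (auto intro: var_degree_le_mult)

text \<open>Each Leibniz product takes one entry from every row, so bounds that are uniform along
  rows add up.\<close>

lemma var_degree_le_det:
  fixes A :: "'a::comm_ring_1 mpoly mat"
  assumes A: "A \<in> carrier_mat N N"
    and d: "\<And>a b. a < N \<Longrightarrow> b < N \<Longrightarrow> var_degree_le t (d a) (A $$ (a, b))"
  shows "var_degree_le t (\<Sum>a<N. d a) (det A)"
  unfolding det_def'[OF A]
proof (rule var_degree_le_sum)
  fix \<pi> assume "\<pi> \<in> {\<pi>. \<pi> permutes {0..<N}}"
  then have "var_degree_le t (\<Sum>a=0..<N. d a) (\<Prod>a=0..<N. A $$ (a, \<pi> a))"
    by (intro var_degree_le_prod d) (auto dest: permutes_in_image[of \<pi> "{0..<N}"])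
  then show "var_degree_le t (\<Sum>a<N. d a) (signof \<pi> * (\<Prod>a=0..<N. A $$ (a, \<pi> a)))"
    by (auto simp: sign_def atLeast0LessThan intro: var_degree_le_uminus)
qed

section \<open>Polynomials determined by their values on a finite field\<close>

lemma reduced_univariate_zero:
  fixes a :: "nat \<Rightarrow> 'a::{field,finite}"
  assumes "\<And>x. (\<Sum>j<card (UNIV :: 'a set). a j * x ^ j) = 0" and "j < card (UNIV :: 'a set)"
  shows "a j = 0"
proof -
  define f where "f = Abs_poly (\<lambda>j. if j < card (UNIV :: 'a set) then a j else 0)"
  have coeff_f: "Polynomial.coeff f = (\<lambda>j. if j < card (UNIV :: 'a set) then a j else 0)"
    unfolding f_def by (rule coeff_Abs_poly[where n = "card (UNIV :: 'a set)"]) auto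
  have deg: "degree f < card (UNIV :: 'a set)"
    by (rule degree_lessI) (auto simp: coeff_f finite_UNIV_card_ge_0)
  have "poly f x = 0" for x
  proof -
    have "poly f x = (\<Sum>j<card (UNIV :: 'a set). Polynomial.coeff f j * x ^ j)"
      unfolding poly_altdef using deg
      by (intro sum.mono_neutral_left) (auto simp: coeff_eq_0)
    also have "\<dots> = 0"
      using assms(1)[of x] by (simp add: coeff_f)
    finally show ?thesis .
  qed
  \<comment> \<open>All field elements are roots, more than the degree allows.\<close>
  with deg have "f = 0"
    by (intro poly_eqI_degree[of UNIV]) auto
  with coeff_f assms(2) show ?thesis
    by (metis coeff_0)
qed

text \<open>Induction on the number of variables: with the other variables fixed, the sum is a
  polynomial in the last one of degree below the field size, so its coefficients vanish. Index set
  and exponents are abstract because the induction passes to the indices with one prescribed last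
  exponent.\<close>

lemma reduced_sum_zero:
  fixes c :: "'b \<Rightarrow> 'a::{field,finite}" and e :: "'b \<Rightarrow> nat \<Rightarrow> nat"
  assumes "finite A"
    and "\<And>m t. m \<in> A \<Longrightarrow> t < r \<Longrightarrow> e m t < card (UNIV :: 'a set)"
    and "\<And>m m'. m \<in> A \<Longrightarrow> m' \<in> A \<Longrightarrow> (\<And>t. t < r \<Longrightarrow> e m t = e m' t) \<Longrightarrow> m = m'"
    and "\<And>v. v \<in> vecspace r \<Longrightarrow> (\<Sum>m\<in>A. c m * (\<Prod>t<r. v t ^ e m t)) = 0"
    and "m \<in> A"
  shows "c m = 0"
  using assms
proof (induction r arbitrary: A m)
  case 0
  then have "A = {m}" by auto
  with "0.prems"(4)[of "\<lambda>_. 0"] show ?case by (simp add: vecspace_def)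
next
  case (Suc r)
  define B where "B j = {m\<in>A. e m r = j}" for j
  have "c m' = 0" if "m' \<in> B j" for m' j
  proof (rule Suc.IH)
    show "finite (B j)" "m' \<in> B j"
      using Suc.prems(1) that by (auto simp: B_def)
    show "m1 = m2" if "m1 \<in> B j" "m2 \<in> B j" "\<And>t. t < r \<Longrightarrow> e m1 t = e m2 t" for m1 m2
      using that by (intro Suc.prems(3)) (auto simp: B_def less_Suc_eq)
    show "e m1 t < card (UNIV :: 'a set)" if "m1 \<in> B j" "t < r" for m1 t
      using that Suc.prems(2) by (simp add: B_def)
    fix v :: "nat \<Rightarrow> 'a" assume v: "v \<in> vecspace r"
    have j: "j < card (UNIV :: 'a set)"
      using that Suc.prems(2)[of m' r] by (simp add: B_def)
    define a where "a j = (\<Sum>m\<in>B j. c m * (\<Prod>t<r. v t ^ e m t))" for j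
    have "(\<Sum>j<card (UNIV :: 'a set). a j * x ^ j) = 0" for x
    proof -
      \<comment> \<open>\<open>v\<close> vanishes from position \<open>r\<close> on, so its entry at
        \<open>r\<close> is free to take the value \<open>x\<close>.\<close>
      have "v(r := x) \<in> vecspace (Suc r)"
        using v by (auto simp: vecspace_def)
      then have "0 = (\<Sum>m\<in>A. c m * (\<Prod>t<Suc r. (v(r := x)) t ^ e m t))"
        using Suc.prems(4) by metis
      also have "\<dots> = (\<Sum>m\<in>A. c m * (\<Prod>t<r. v t ^ e m t) * x ^ e m r)"
        by (intro sum.cong) auto
      also have "\<dots> = (\<Sum>j<card (UNIV :: 'a set). \<Sum>m\<in>B j. c m * (\<Prod>t<r. v t ^ e m t) * x ^ e m r)"
        unfolding B_def
        by (rule sum.group[symmetric]) (use Suc.prems(1,2) in auto)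
      also have "\<dots> = (\<Sum>j<card (UNIV :: 'a set). a j * x ^ j)"
        unfolding a_def sum_distrib_right by (intro sum.cong) (auto simp: B_def)
      finally show ?thesis by simp
    qed
    from reduced_univariate_zero[OF this j]
    show "(\<Sum>m\<in>B j. c m * (\<Prod>t<r. v t ^ e m t)) = 0"
      by (simp add: a_def)
  qed
  with Suc.prems(5) show ?case by (auto simp: B_def)
qed

text \<open>The bound 0 from \<open>r\<close> on confines \<open>f\<close> to the first
  \<open>r\<close> variables, so distinct monomials differ in one of these exponents, as
  \<open>reduced_sum_zero\<close> requires.\<close>

lemma reduced_mpoly_zero:
  fixes f :: "'a::{field,finite} mpoly"
  assumes lt: "\<And>t. t < r \<Longrightarrow> var_degree_le t (card (UNIV :: 'a set) - 1) f"
    and ge: "\<And>t. t \<ge> r \<Longrightarrow> var_degree_le t 0 f"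
    and zero: "\<And>v. v \<in> vecspace r \<Longrightarrow> mpoly_eval v f = 0"
  shows "f = 0"
proof -
  have out: "Poly_Mapping.lookup m t = 0" if "m \<in> Poly_Mapping.keys f" "t \<ge> r" for m t
    using ge[OF that(2)] that(1) by (auto simp: var_degree_le_def)
  have "Poly_Mapping.lookup f m = 0" if "m \<in> Poly_Mapping.keys f" for m
  proof (rule reduced_sum_zero[of "Poly_Mapping.keys f" r Poly_Mapping.lookup "Poly_Mapping.lookup f"])
    show "Poly_Mapping.lookup m t < card (UNIV :: 'a set)" if "m \<in> Poly_Mapping.keys f" "t < r" for m t
    proof -
      have "Poly_Mapping.lookup m t \<le> card (UNIV :: 'a set) - 1"
        using lt[OF that(2)] that(1) by (simp add: var_degree_le_def)
      moreover have "0 < card (UNIV :: 'a set)" by (simp add: finite_UNIV_card_ge_0)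
      ultimately show ?thesis by linarith
    qed
    show "m = m'"
      if "m \<in> Poly_Mapping.keys f" "m' \<in> Poly_Mapping.keys f"
        "\<And>t. t < r \<Longrightarrow> Poly_Mapping.lookup m t = Poly_Mapping.lookup m' t" for m m'
      using that out by (intro poly_mapping_eqI) (metis linorder_not_le)
    show "(\<Sum>m\<in>Poly_Mapping.keys f. Poly_Mapping.lookup f m * (\<Prod>t<r. v t ^ Poly_Mapping.lookup m t)) = 0"
      if "v \<in> vecspace r" for v
    proof -
      have "monom_eval v m = (\<Prod>t<r. v t ^ Poly_Mapping.lookup m t)" if "m \<in> Poly_Mapping.keys f" for m
        by (rule monom_eval_superset) (auto simp: in_keys_iff intro: ccontr dest: out[OF that, OF leI])
      with zero[OF \<open>v \<in> vecspace r\<close>] show ?thesis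
        by (simp add: mpoly_eval_def)
    qed
  qed (use that in auto)
  then show ?thesis
    by (intro poly_mapping_eqI) (auto simp: in_keys_iff)
qed

section \<open>Subspaces over the fixed field of Frobenius\<close>

lemma card_vecspace: "card (vecspace r :: (nat \<Rightarrow> 'a::{field,finite}) set) = card (UNIV :: 'a set) ^ r"
proof -
  let ?L = "{xs :: 'a list. set xs \<subseteq> UNIV \<and> length xs = r}"
  have "bij_betw (\<lambda>xs i. if i < r then xs ! i else 0) ?L (vecspace r :: (nat \<Rightarrow> 'a) set)"
  proof (rule bij_betwI[where g = "\<lambda>v. map v [0..<r]"])
    fix xs :: "'a list" assume "xs \<in> ?L"
    then show "map (\<lambda>i. if i < r then xs ! i else 0) [0..<r] = xs"
      by (intro nth_equalityI) auto
  qed (auto simp: vecspace_def)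
  from bij_betw_same_card[OF this] show ?thesis
    by (simp only: card_lists_length_eq finite)
qed

lemma finite_vecspace: "finite (vecspace r :: (nat \<Rightarrow> 'a::{field,finite}) set)"
  using card_vecspace[where 'a = 'a, of r]
  by (metis card.infinite finite_UNIV_card_ge_0 finite less_not_refl zero_less_power)

lemma vecspace_scale: "v \<in> vecspace r \<Longrightarrow> (\<lambda>i. c * v i) \<in> vecspace r"
  by (simp add: vecspace_def)

lemma Fspan_scale:
  assumes "c \<noteq> (0::'a::field)"
  shows "Fspan (\<lambda>i. c * v i) = Fspan v"
proof
  show "Fspan (\<lambda>i. c * v i) \<subseteq> Fspan v"
    by (auto simp: Fspan_def mult.assoc[symmetric])
  show "Fspan v \<subseteq> Fspan (\<lambda>i. c * v i)"
  proof
    fix w assume "w \<in> Fspan v"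
    then obtain d where "w = (\<lambda>i. d * v i)" by (auto simp: Fspan_def)
    then have "w = (\<lambda>i. (d / c) * (c * v i))" using assms by auto
    then show "w \<in> Fspan (\<lambda>i. c * v i)" unfolding Fspan_def by blast
  qed
qed

text \<open>Equality of linear sets enters both halves of the theorem in this form, as a condition
  on scalar multiples of a vector.\<close>

lemma Fspan_in_linset_iff:
  assumes "v \<noteq> (\<lambda>_. 0)"
  shows "Fspan v \<in> linset U \<longleftrightarrow> (\<exists>c. c \<noteq> 0 \<and> (\<lambda>i. c * v i) \<in> U)"
proof
  assume "Fspan v \<in> linset U"
  then obtain u where u: "Fspan v = Fspan u" "u \<in> U" "u \<noteq> (\<lambda>_. 0)"
    by (auto simp: linset_def)
  have "u = (\<lambda>i. 1 * u i)" by simp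
  then have "u \<in> Fspan u" unfolding Fspan_def by blast
  then obtain c where "u = (\<lambda>i. c * v i)"
    using u(1) by (auto simp: Fspan_def)
  with u(2,3) show "\<exists>c. c \<noteq> 0 \<and> (\<lambda>i. c * v i) \<in> U" by (intro exI[of _ c]) auto
next
  assume "\<exists>c. c \<noteq> 0 \<and> (\<lambda>i. c * v i) \<in> U"
  then obtain c where c: "c \<noteq> 0" "(\<lambda>i. c * v i) \<in> U" by blast
  have "(\<lambda>i. c * v i) \<noteq> (\<lambda>_. 0)"
    using c(1) assms by (auto simp: fun_eq_iff)
  then show "Fspan v \<in> linset U"
    using c Fspan_scale[of c v] unfolding linset_def by blast
qed

text \<open>\<open>x^d - g(x)\<close> is monic of degree \<open>d\<close>. Applied to
  \<open>x^q = x\<close> and to the fibres of the norm.\<close>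

lemma card_power_eq_poly_le:
  fixes g :: "'a::idom poly"
  assumes "degree g < d"
  shows "card {x. x ^ d = poly g x} \<le> d"
proof -
  let ?f = "Polynomial.monom 1 d - g"
  have "Polynomial.coeff ?f d = 1"
    using assms by (simp add: coeff_eq_0)
  then have "?f \<noteq> 0" by (metis coeff_0 zero_neq_one)
  then have "card {x. poly ?f x = 0} \<le> degree ?f"
    by (rule card_poly_roots_bound)
  also have "\<dots> \<le> d"
    using assms by (intro degree_diff_le) (simp_all add: degree_monom_le)
  finally show ?thesis by (simp add: poly_monom)
qed

section \<open>Finite fields of order \<open>q^n\<close> and their subfield of order
  \<open>q\<close>\<close>

locale finite_field_extension =
  fixes F :: "'a::{field,finite} itself" and p k q n :: nat
  assumes prime_p: "prime p" and k_pos: "k \<ge> 1" and q_def: "q = p ^ k" and n_pos: "n \<ge> 1"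
    and card_field: "card (UNIV :: 'a set) = q ^ n"
begin

lemma q_ge_2: "q \<ge> 2"
proof -
  have "p ^ 1 \<le> p ^ k" using k_pos prime_p by (intro power_increasing) (auto dest: prime_ge_1_nat)
  then show ?thesis using prime_ge_2_nat[OF prime_p] by (simp add: q_def)
qed

text \<open>Translation by 1 permutes the field, so the sum of all elements does not change when
  \<open>q^n\<close> ones are added to it.\<close>

lemma of_nat_card_field: "of_nat (q ^ n) = (0::'a)"
proof -
  have "(\<Sum>x\<in>UNIV. x) = (\<Sum>x\<in>UNIV. x + 1 :: 'a)"
    by (rule sum.reindex_bij_witness[of _ "\<lambda>x. x + 1" "\<lambda>x. x - 1"]) auto
  then show ?thesis by (simp add: sum.distrib card_field)
qed

lemma CHAR_eq: "CHAR('a) = p"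
proof -
  have "prime CHAR('a)"
    by (rule prime_CHAR_semidom) (simp add: finite_imp_CHAR_pos)
  moreover have "CHAR('a) dvd p ^ (k * n)"
    using of_nat_card_field unfolding of_nat_eq_0_iff_char_dvd by (simp add: q_def power_mult)
  ultimately show ?thesis
    using prime_p by (metis prime_dvd_power primes_dvd_imp_eq)
qed

lemma of_nat_q: "of_nat q = (0::'a)"
  unfolding of_nat_eq_0_iff_char_dvd CHAR_eq using k_pos by (simp add: q_def)

lemma frobenius_add: "(x + y :: 'a) ^ (q ^ j) = x ^ (q ^ j) + y ^ (q ^ j)"
  by (rule freshmans_dream'[where n = "k * j"]) (simp_all add: CHAR_eq prime_p q_def power_mult)

lemma frobenius_sum: "(\<Sum>i\<in>I. f i :: 'a) ^ (q ^ j) = (\<Sum>i\<in>I. f i ^ (q ^ j))"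
  by (rule freshmans_dream_sum'[where n = "k * j"]) (simp_all add: CHAR_eq prime_p q_def power_mult)

lemma frobenius_hom: "comm_ring_hom (\<lambda>x::'a. x ^ q)"
  using frobenius_add[of _ _ 1] q_ge_2 by unfold_locales (simp_all add: power_mult_distrib)

text \<open>Multiplication by a nonzero \<open>x\<close> permutes the nonzero elements; comparing
  their product before and after gives \<open>x^(q^n - 1) = 1\<close>.\<close>

lemma power_card_field: "(x::'a) ^ (q ^ n) = x"
proof (cases "x = 0")
  case False
  let ?N = "UNIV - {0::'a}"
  have "(\<Prod>y\<in>?N. y) = (\<Prod>y\<in>?N. x * y)"
    by (rule prod.reindex_bij_witness[of _ "\<lambda>y. x * y" "\<lambda>y. y / x"]) (use False in auto)
  also have "\<dots> = x ^ (q ^ n - 1) * (\<Prod>y\<in>?N. y)"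
    by (simp add: prod.distrib card_field)
  finally have "x ^ (q ^ n - 1) = 1" by simp
  moreover have "x ^ (q ^ n) = x * x ^ (q ^ n - 1)"
    using q_ge_2 by (metis power_eq_if power_not_zero not_numeral_le_zero)
  ultimately show ?thesis by simp
qed (use q_ge_2 in simp)

lemma Fq_zero [simp]: "(0::'a) \<in> Fq q" and Fq_one [simp]: "(1::'a) \<in> Fq q"
  using q_ge_2 by (auto simp: Fq_def)

lemma Fq_add: "(x::'a) \<in> Fq q \<Longrightarrow> y \<in> Fq q \<Longrightarrow> x + y \<in> Fq q"
  using frobenius_add[of x y 1] by (simp add: Fq_def)

lemma Fq_divide: "(x::'a) \<in> Fq q \<Longrightarrow> y \<in> Fq q \<Longrightarrow> x / y \<in> Fq q"
  by (simp add: Fq_def power_divide)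

lemma Fq_uminus: "(x::'a) \<in> Fq q \<Longrightarrow> - x \<in> Fq q"
proof -
  interpret comm_ring_hom "\<lambda>x::'a. x ^ q" by (rule frobenius_hom)
  show "x \<in> Fq q \<Longrightarrow> - x \<in> Fq q" by (simp add: Fq_def hom_uminus)
qed

lemma Fq_power_q_power: "(x::'a) \<in> Fq q \<Longrightarrow> x ^ (q ^ j) = x"
  by (induction j) (simp_all add: Fq_def power_mult)

text \<open>Stated with \<open>Suc\<close> to avoid a truncated subtraction. The sum is both the
  exponent of the relative norm and the degree bound of \<open>det_poly\<close> in each
  variable.\<close>

lemma geometric_sum_q: "Suc ((q - 1) * (\<Sum>i<m. q ^ i)) = q ^ m"
proof -
  obtain a where "q = Suc a" using q_ge_2 by (cases q) auto
  then show ?thesis by (induction m) (simp_all add: algebra_simps)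
qed

text \<open>The relative norm maps the nonzero field elements into the nonzero elements of \<open>F\<^sub>q\<close> with
  fibres of at most \<open>(q\<^sup>n - 1) / (q - 1)\<close> elements, which forces \<open>q - 1\<close> values.\<close>

lemma card_Fq: "card (Fq q :: 'a set) = q"
proof (rule antisym)
  have "Fq q = {x::'a. x ^ q = poly [:0, 1:] x}" by (simp add: Fq_def)
  then show "card (Fq q :: 'a set) \<le> q"
    using card_power_eq_poly_le[of "[:0, 1::'a:]" q] q_ge_2 by simp
  define N where "N = (\<Sum>i<n. q ^ i)"
  have N: "Suc ((q - 1) * N) = q ^ n"
    unfolding N_def by (rule geometric_sum_q)
  have "q ^ n > 1" using q_ge_2 n_pos by (intro one_less_power) auto
  then have "N > 0" using N by (intro gr0I) simp
  have roots: "card {x::'a. x ^ N = c} \<le> N" for c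
    using card_power_eq_poly_le[of "[:c:]" N] \<open>N > 0\<close> by simp
  let ?X = "UNIV - {0::'a}"
  have norm: "x ^ N \<in> Fq q - {0}" if "x \<in> ?X" for x
  proof -
    have "x * x ^ ((q - 1) * N) = x" using power_card_field[of x] unfolding N[symmetric] by simp
    then have "(x ^ N) ^ (q - 1) = 1" using that by (simp add: power_mult mult.commute)
    then have "(x ^ N) ^ Suc (q - 1) = x ^ N" by simp
    then show ?thesis using that q_ge_2 by (simp add: Fq_def)
  qed
  have "?X = (\<Union>y\<in>Fq q - {0}. {x\<in>?X. x ^ N = y})"
    using norm by blast
  then have "card ?X \<le> (\<Sum>y\<in>Fq q - {0}. card {x\<in>?X. x ^ N = y})"
    using card_UN_le[of "Fq q - {0}" "\<lambda>y. {x\<in>?X. x ^ N = y}"] by (metis (no_types) finite)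
  also have "\<dots> \<le> (\<Sum>y\<in>Fq q - {0 :: 'a}. N)"
    by (intro sum_mono order_trans[OF card_mono roots]) auto
  also have "\<dots> = (card (Fq q :: 'a set) - 1) * N"
    by simp
  finally have "(q - 1) * N \<le> (card (Fq q :: 'a set) - 1) * N"
    using N[symmetric] by (simp add: card_field)
  with \<open>N > 0\<close> q_ge_2 show "q \<le> card (Fq q :: 'a set)" by simp
qed

section \<open>Bases and dimension over the subfield by counting\<close>

lemma Fq_subspace_finite: "Fq_subspace q r (S :: (nat \<Rightarrow> 'a) set) \<Longrightarrow> finite S"
  using finite_vecspace finite_subset unfolding Fq_subspace_def by blast

lemma Fq_subspace_uminus: "Fq_subspace q r S \<Longrightarrow> u \<in> S \<Longrightarrow> (\<lambda>i. - u i :: 'a) \<in> S"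
  unfolding Fq_subspace_def using Fq_uminus[OF Fq_one] by fastforce

lemma Fq_subspace_diff:
  assumes S: "Fq_subspace q r S" and "u \<in> S" "v \<in> S"
  shows "(\<lambda>i. u i - v i :: 'a) \<in> S"
proof -
  have add: "\<forall>u\<in>S. \<forall>v\<in>S. (\<lambda>i. u i + v i) \<in> S"
    using S by (simp add: Fq_subspace_def)
  from add[rule_format, OF assms(2) Fq_subspace_uminus[OF S assms(3)]] show ?thesis by simp
qed

lemma Fq_subspace_sum:
  assumes "Fq_subspace q r S" "finite I" "\<And>j. j \<in> I \<Longrightarrow> c j \<in> Fq q \<and> u j \<in> S"
  shows "(\<lambda>i. \<Sum>j\<in>I. c j * u j i :: 'a) \<in> S"
  using assms(2,3)
proof (induction I rule: finite_induct)
  case empty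
  then show ?case using assms(1) by (simp add: Fq_subspace_def)
next
  case (insert j I)
  then have "(\<lambda>i. c j * u j i) \<in> S"
    using assms(1) unfolding Fq_subspace_def by blast
  with insert show ?case
    using assms(1) unfolding Fq_subspace_def by simp
qed

lemma Fq_lincomb_in:
  assumes "Fq_subspace q r S" "set us \<subseteq> S" "length cs = length us" "set cs \<subseteq> (Fq q :: 'a set)"
  shows "Fq_lincomb us cs \<in> S"
  unfolding Fq_lincomb_def using assms by (intro Fq_subspace_sum[OF assms(1)]) (auto dest: nth_mem)

definition Fq_independent :: "(nat \<Rightarrow> 'a) list \<Rightarrow> bool" where
  "Fq_independent us \<longleftrightarrow> (\<forall>cs. length cs = length us \<and> set cs \<subseteq> Fq q \<and>
     Fq_lincomb us cs = (\<lambda>_. 0) \<longrightarrow> (\<forall>c\<in>set cs. c = 0))"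

lemma inj_on_Fq_lincomb:
  assumes "Fq_independent us"
  shows "inj_on (Fq_lincomb us) {cs. set cs \<subseteq> Fq q \<and> length cs = length us}"
proof (rule inj_onI, safe)
  fix cs ds :: "'a list"
  assume cs: "set cs \<subseteq> Fq q" "length cs = length us" and ds: "set ds \<subseteq> Fq q" "length ds = length us"
    and eq: "Fq_lincomb us cs = Fq_lincomb us ds"
  define es where "es = map (\<lambda>j. cs ! j + - (ds ! j)) [0..<length us]"
  have es: "length es = length us" "set es \<subseteq> Fq q"
    using cs ds by (auto simp: es_def simp del: add_uminus_conv_diff intro!: Fq_add Fq_uminus dest: nth_mem)
  have "Fq_lincomb us es i = Fq_lincomb us cs i - Fq_lincomb us ds i" for i
    by (simp add: Fq_lincomb_def es_def algebra_simps sum_subtractf)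
  then have "Fq_lincomb us es = (\<lambda>_. 0)" using eq by auto
  with assms es have "\<forall>c\<in>set es. c = 0" unfolding Fq_independent_def by blast
  then have "\<forall>j<length us. cs ! j = ds ! j" by (auto simp: es_def)
  then show "cs = ds" using cs ds by (intro nth_equalityI) auto
qed

lemma card_image_Fq_lincomb:
  assumes "Fq_independent us"
  shows "card (Fq_lincomb us ` {cs. set cs \<subseteq> Fq q \<and> length cs = length us}) = q ^ length us"
  using card_image[OF inj_on_Fq_lincomb[OF assms]]
  by (simp add: card_lists_length_eq card_Fq)

text \<open>Counting stands in for exchange arguments: \<open>q^length us\<close> depends only on
  \<open>S\<close>, so all bases have the same length.\<close>

lemma card_eq_of_Fq_basis:
  assumes "Fq_subspace q r S" "Fq_basis q S us"
  shows "card S = q ^ length (us :: (nat \<Rightarrow> 'a) list)"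
proof -
  have "S = Fq_lincomb us ` {cs. set cs \<subseteq> Fq q \<and> length cs = length us}"
    using assms Fq_lincomb_in[OF assms(1)] unfolding Fq_basis_def by blast
  moreover have "Fq_independent us"
    using assms(2) by (simp add: Fq_basis_def Fq_independent_def)
  ultimately show ?thesis using card_image_Fq_lincomb by metis
qed

text \<open>A nonzero coefficient \<open>d\<close> of \<open>w\<close> could be divided out, which
  would express \<open>w\<close> through \<open>us\<close>.\<close>

lemma Fq_independent_Cons:
  assumes us: "Fq_independent us"
    and w: "w \<notin> Fq_lincomb us ` {cs. set cs \<subseteq> Fq q \<and> length cs = length us}"
  shows "Fq_independent (w # us)"
  unfolding Fq_independent_def
proof (intro allI impI)
  fix cs :: "'a list"
  assume cs: "length cs = length (w # us) \<and> set cs \<subseteq> Fq q \<and> Fq_lincomb (w # us) cs = (\<lambda>_. 0)"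
  then obtain d ds where d: "cs = d # ds" "length ds = length us" "d \<in> Fq q" "set ds \<subseteq> Fq q"
    by (cases cs) auto
  have comb: "d * w i + Fq_lincomb us ds i = 0" for i
    using cs[THEN conjunct2, THEN conjunct2, THEN fun_cong, of i]
    by (simp add: d(1) Fq_lincomb_def sum.lessThan_Suc_shift del: sum.lessThan_Suc)
  have "d = 0"
  proof (rule ccontr)
    assume "d \<noteq> 0"
    have "w i = Fq_lincomb us (map (\<lambda>x. - (x / d)) ds) i" for i
    proof -
      have "Fq_lincomb us (map (\<lambda>x. - (x / d)) ds) i = - (Fq_lincomb us ds i / d)"
        using d(2) by (simp add: Fq_lincomb_def sum_negf sum_divide_distrib)
      also have "Fq_lincomb us ds i = - (d * w i)"
        using comb[of i] by (simp add: eq_neg_iff_add_eq_0 add.commute)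
      finally show ?thesis using \<open>d \<noteq> 0\<close> by simp
    qed
    then have "w = Fq_lincomb us (map (\<lambda>x. - (x / d)) ds)" by (rule ext)
    moreover have "set (map (\<lambda>x. - (x / d)) ds) \<subseteq> Fq q"
      using d by (auto intro!: Fq_uminus Fq_divide)
    ultimately show False using w d(2) by (metis (mono_tags, lifting) imageI length_map mem_Collect_eq)
  qed
  moreover have "\<forall>c\<in>set ds. c = 0"
    using us d \<open>d = 0\<close> comb unfolding Fq_independent_def by (auto simp: fun_eq_iff)
  ultimately show "\<forall>c\<in>set cs. c = 0" by (simp add: d(1))
qed

text \<open>A longest independent list in \<open>S\<close> is a basis. Lengths are bounded because a
  list of length \<open>l\<close> has \<open>q^l > l\<close> distinct combinations in
  \<open>S\<close>.\<close>

lemma Fq_basis_exists: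
  assumes S: "Fq_subspace q r (S :: (nat \<Rightarrow> 'a) set)"
  obtains us where "Fq_basis q S us"
proof -
  let ?comb = "\<lambda>us. Fq_lincomb us ` {cs. set cs \<subseteq> Fq q \<and> length cs = length us}"
  define P where "P us \<longleftrightarrow> set us \<subseteq> S \<and> Fq_independent us" for us
  have in_S: "?comb us \<subseteq> S" if "P us" for us
    using Fq_lincomb_in[OF S] that by (auto simp: P_def)
  have bound: "length us \<le> card S" if "P us" for us
  proof -
    have "length us < 2 ^ length us" by simp
    also have "\<dots> \<le> q ^ length us" using q_ge_2 by (simp add: power_mono)
    also have "\<dots> = card (?comb us)" using that card_image_Fq_lincomb by (simp add: P_def)
    also have "\<dots> \<le> card S" using in_S[OF that] Fq_subspace_finite[OF S] by (rule card_mono[rotated])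
    finally show ?thesis by simp
  qed
  have "P []" by (simp add: P_def Fq_independent_def)
  then obtain us where us: "P us" and max: "\<And>vs. P vs \<Longrightarrow> length vs \<le> length us"
    using ex_has_greatest_nat[of P "[]" length "Suc (card S)"] bound by (meson le_imp_less_Suc)
  have "w \<in> ?comb us" if "w \<in> S" for w
  proof (rule ccontr)
    assume "w \<notin> ?comb us"
    then have "P (w # us)" using us that Fq_independent_Cons by (simp add: P_def)
    from max[OF this] show False by simp
  qed
  then have "Fq_basis q S us"
    using us unfolding Fq_basis_def P_def Fq_independent_def by blast
  then show ?thesis by (rule that)
qed

text \<open>\<open>Fq_dim\<close> is a definite description, so uniqueness of the length is derived
  from the count. Weights are later compared as cardinalities.\<close>

lemma card_eq_Fq_dim:
  assumes S: "Fq_subspace q r (S :: (nat \<Rightarrow> 'a) set)"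
  shows "card S = q ^ Fq_dim q S"
proof -
  obtain us where us: "Fq_basis q S us" using Fq_basis_exists[OF S] by blast
  have "Fq_dim q S = length us"
    unfolding Fq_dim_def
  proof (rule the_equality)
    fix l assume "\<exists>vs. Fq_basis q S vs \<and> length vs = l"
    then show "l = length us"
      using card_eq_of_Fq_basis[OF S] us q_ge_2
      by (metis less_le_trans one_less_numeral_iff power_inject_exp semiring_norm(76))
  qed (use us in blast)
  with card_eq_of_Fq_basis[OF S us] show ?thesis by simp
qed

lemma Fq_dim_eq_iff_card_eq:
  assumes "Fq_subspace q r (S :: (nat \<Rightarrow> 'a) set)" "Fq_subspace q r (T :: (nat \<Rightarrow> 'a) set)"
  shows "Fq_dim q S = Fq_dim q T \<longleftrightarrow> card S = card T"
  using q_ge_2 by (simp add: card_eq_Fq_dim[OF assms(1)] card_eq_Fq_dim[OF assms(2)])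

end

section \<open>Weights\<close>

text \<open>Orders add up under products, and a linear factor contributes 1 exactly if its root is
  \<open>a\<close>.\<close>

lemma order_prod_linear:
  fixes f :: "'b \<Rightarrow> 'a::idom"
  assumes "finite A"
  shows "Polynomial.order a (\<Prod>x\<in>A. [:- f x, 1:]) = card {x\<in>A. f x = a}"
  using assms
proof (induction A rule: finite_induct)
  case empty
  then show ?case by (simp add: order_0I)
next
  case (insert y A)
  have "Polynomial.order a [:- f y, 1:] = (if f y = a then 1 else 0)"
    using order_power_n_n[of a 1] by (auto intro: order_0I)
  moreover have "{x\<in>insert y A. f x = a} = (if f y = a then insert y {x\<in>A. f x = a} else {x\<in>A. f x = a})"
    by auto
  moreover have "[:- f y, 1:] * (\<Prod>x\<in>A. [:- f x, 1:]) \<noteq> 0"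
    unfolding mult_eq_0_iff using insert by auto
  ultimately show ?case
    using insert by (simp add: order_mult del: mult_pCons_left)
qed

context finite_field_extension
begin

text \<open>The multiples of \<open>z\<close> meet \<open>U\<close> only in 0, so
  \<open>(u, c)\<close> to \<open>u + c z\<close> is injective, and \<open>q^(rn-n)\<close> times
  \<open>q^n\<close> is the size of the whole space.\<close>

lemma complement_decomposition:
  assumes U: "Fq_subspace q r (U :: (nat \<Rightarrow> 'a) set)" and card_U: "card U = q ^ (r*n - n)" and r: "r \<ge> 1"
    and z: "z \<in> vecspace r" and out: "\<And>c. c \<noteq> 0 \<Longrightarrow> (\<lambda>i. c * z i) \<notin> U"
    and w: "w \<in> vecspace r"
  obtains u c where "u \<in> U" "w = (\<lambda>i. u i + c * z i)"
proof -
  let ?f = "\<lambda>(u, c) i. u i + c * z i"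
  have inj: "inj_on ?f (U \<times> UNIV)"
  proof (rule inj_onI, clarify)
    fix u c u' c' assume u: "u \<in> U" "u' \<in> U" and eq: "(\<lambda>i. u i + c * z i) = (\<lambda>i. u' i + c' * z i)"
    have "(c - c') * z i = u' i - u i" for i
      using fun_cong[OF eq, of i] by (simp add: algebra_simps)
    then have "(\<lambda>i. (c - c') * z i) \<in> U"
      using Fq_subspace_diff[OF U u(2,1)] by simp
    then have "c = c'" using out by (metis eq_iff_diff_eq_0)
    with eq show "u = u' \<and> c = c'" by (auto simp: fun_eq_iff)
  qed
  have sub: "?f ` (U \<times> UNIV) \<subseteq> vecspace r"
    using U z by (auto simp: Fq_subspace_def vecspace_def)
  have "n \<le> r * n" using r by simp
  then have "card (?f ` (U \<times> UNIV)) = card (vecspace r :: (nat \<Rightarrow> 'a) set)"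
    by (simp add: card_image[OF inj] card_cartesian_product card_U card_field card_vecspace
        power_add[symmetric] power_mult[symmetric] mult.commute)
  then have "?f ` (U \<times> UNIV) = vecspace r"
    by (rule card_subset_eq[OF finite_vecspace sub])
  with w have "w \<in> ?f ` (U \<times> UNIV)" by simp
  with that show ?thesis by (auto simp: image_iff)
qed

text \<open>Otherwise every nonzero vector would be a nonzero scalar times a nonzero vector of
  \<open>U\<close>, and there are too few such pairs.\<close>

lemma exists_outside:
  assumes U: "Fq_subspace q r (U :: (nat \<Rightarrow> 'a) set)" and card_U: "card U = q ^ (r*n - n)" and r: "r \<ge> 2"
  obtains z where "z \<in> vecspace r" "z \<noteq> (\<lambda>_. 0)" "\<And>c. c \<noteq> 0 \<Longrightarrow> (\<lambda>i. c * z i) \<notin> U"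
proof (rule ccontr)
  assume no: "\<not> thesis"
  let ?O = "\<lambda>_::nat. 0 :: 'a"
  let ?f = "\<lambda>(c, u) i. c * u i :: 'a"
  let ?D = "(UNIV - {0::'a}) \<times> (U - {?O})"
  have fin: "finite U" by (rule Fq_subspace_finite[OF U])
  have "vecspace r - {?O} \<subseteq> ?f ` ?D"
  proof
    fix z assume z: "z \<in> vecspace r - {?O}"
    with no that obtain c where c: "c \<noteq> 0" "(\<lambda>i. c * z i) \<in> U" by blast
    moreover have "(\<lambda>i. c * z i) \<noteq> ?O" using c(1) z by (auto simp: fun_eq_iff)
    moreover have "z = ?f (1 / c, \<lambda>i. c * z i)" using c(1) by auto
    ultimately show "z \<in> ?f ` ?D" by (intro image_eqI[of _ _ "(1 / c, \<lambda>i. c * z i)"]) auto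
  qed
  moreover have fin_D: "finite ?D" using fin by auto
  ultimately have "card (vecspace r - {?O}) \<le> card (?f ` ?D)"
    by (intro card_mono finite_imageI)
  also have "\<dots> \<le> card ?D" using fin_D by (rule card_image_le)
  finally have "card (vecspace r - {?O}) \<le> card ?D" .
  moreover have "card (vecspace r - {?O}) = q ^ n * q ^ (r*n - n) - 1"
  proof -
    have "?O \<in> vecspace r" by (simp add: vecspace_def)
    moreover have "n \<le> r * n" using r by simp
    ultimately show ?thesis
      by (simp add: card_vecspace card_field power_add[symmetric] power_mult[symmetric] mult.commute)
  qed
  moreover have "card ?D = (q ^ n - 1) * (q ^ (r*n - n) - 1)"
    using U by (simp add: card_cartesian_product card_field card_U Fq_subspace_def)
  ultimately have le: "q ^ n * q ^ (r*n - n) - 1 \<le> (q ^ n - 1) * (q ^ (r*n - n) - 1)" by simp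
  have "q ^ n > 1" using q_ge_2 n_pos by (intro one_less_power) auto
  \<comment> \<open>Writing both powers, which exceed 1, as \<open>a + 2\<close> and
    \<open>b + 2\<close> removes the truncated subtractions from \<open>le\<close>.\<close>
  then obtain a where a: "q ^ n = Suc (Suc a)" by (metis less_imp_Suc_add plus_1_eq_Suc One_nat_def add_Suc)
  have "1 * n < r * n" using r n_pos by (intro mult_strict_right_mono) auto
  then have "q ^ (r*n - n) > 1" using q_ge_2 by (intro one_less_power) auto
  then obtain b where b: "q ^ (r*n - n) = Suc (Suc b)" by (metis less_imp_Suc_add plus_1_eq_Suc One_nat_def add_Suc)
  from le show False unfolding a b by simp
qed

text \<open>The value is \<open>1\<close> at a \<open>t\<close> that is not a root since \<open>x \<mapsto> x t - g(x)\<close> then permutes the nonzero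
  field elements.\<close>

lemma pencil_polynomial:
  assumes U: "Fq_subspace q r (U :: (nat \<Rightarrow> 'a) set)" and card_U: "card U = q ^ (r*n - n)" and r: "r \<ge> 1"
    and z: "z \<in> vecspace r" and out: "\<And>c. c \<noteq> 0 \<Longrightarrow> (\<lambda>i. c * z i) \<notin> U"
    and v: "v \<in> vecspace r" "v \<noteq> (\<lambda>_. 0)"
  obtains H where "degree H < q ^ n"
    and "\<forall>t. poly H t = (if \<exists>c. c \<noteq> 0 \<and> (\<lambda>i. c * (v i + t * z i)) \<in> U then 0 else 1)"
    and "Polynomial.order 0 H = card (Fspan v \<inter> U) - 1"
proof -
  \<comment> \<open>The space is the direct sum of \<open>U\<close> and the multiples of
    \<open>z\<close>, so \<open>x v + c z\<close> lies in \<open>U\<close> for exactly one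
    \<open>c\<close>, called \<open>g x\<close> below.\<close>
  have "\<exists>c. (\<lambda>i. x * v i + c * z i) \<in> U" for x
  proof -
    obtain u c where "u \<in> U" "(\<lambda>i. x * v i) = (\<lambda>i. u i + c * z i)"
      using complement_decomposition[OF U card_U r z out vecspace_scale[OF v(1)]] by metis
    then have "(\<lambda>i. x * v i + (- c) * z i) \<in> U"
      by (simp add: fun_eq_iff)
    then show ?thesis by blast
  qed
  then obtain g where g: "\<And>x. (\<lambda>i. x * v i + g x * z i) \<in> U" by metis
  have uniq: "c = g x" if "(\<lambda>i. x * v i + c * z i) \<in> U" for x c
  proof -
    have "(\<lambda>i. (c - g x) * z i) \<in> U"
      using Fq_subspace_diff[OF U that g[of x]] by (simp add: algebra_simps)
    then show ?thesis using out by (metis eq_iff_diff_eq_0)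
  qed
  have in_U_iff: "(\<lambda>i. x * v i + c * z i) \<in> U \<longleftrightarrow> c = g x" for x c
    using g uniq by blast
  have g_diff: "g (x - y) = g x - g y" for x y
    by (rule uniq[symmetric]) (use Fq_subspace_diff[OF U g[of x] g[of y]] in \<open>simp add: algebra_simps\<close>)
  have g_0: "g 0 = 0" using g_diff[of 0 0] by simp
  let ?X = "UNIV - {0::'a}"
  define H where "H = (\<Prod>x\<in>?X. [:- (g x / x), 1:])"
  have "degree H = card ?X"
    unfolding H_def by (subst degree_prod_eq_sum_degree) auto
  moreover have "0 < q ^ n" using q_ge_2 by simp
  ultimately have deg: "degree H < q ^ n" by (simp add: card_field)
  have val: "poly H t = (if \<exists>c. c \<noteq> 0 \<and> (\<lambda>i. c * (v i + t * z i)) \<in> U then 0 else 1)" for t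
  proof -
    \<comment> \<open>For nonzero \<open>c\<close>, membership thus says that
      \<open>t = g(c)/c\<close>, a root of \<open>H\<close>.\<close>
    have iff: "(\<lambda>i. c * (v i + t * z i)) \<in> U \<longleftrightarrow> c * t = g c" for c
      using in_U_iff[of c "c * t"] by (simp add: algebra_simps)
    have poly_H: "poly H t = (\<Prod>x\<in>?X. t - g x / x)"
      by (simp add: H_def poly_prod)
    show ?thesis
    proof (cases "\<exists>c. c \<noteq> 0 \<and> c * t = g c")
      case True
      then obtain c where "c \<noteq> 0" "c * t = g c" by blast
      then have "c \<in> ?X" "t - g c / c = 0" by (auto dest: sym)
      then have "poly H t = 0" unfolding poly_H by (intro prod_zero) auto
      with True show ?thesis by (simp add: iff)
    next
      case False
      have inj: "inj (\<lambda>x. x * t - g x)"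
      proof (rule injI)
        fix x y assume "x * t - g x = y * t - g y"
        then have "(x - y) * t = g (x - y)" by (simp add: g_diff algebra_simps)
        with False show "x = y" by (metis eq_iff_diff_eq_0)
      qed
      have "bij_betw (\<lambda>x. x * t - g x) ?X ?X"
        unfolding bij_betw_def
      proof
        show "inj_on (\<lambda>x. x * t - g x) ?X" using inj by (rule inj_on_subset) simp
        have "(\<lambda>x. x * t - g x) ` ?X \<subseteq> ?X" using False by auto
        then show "(\<lambda>x. x * t - g x) ` ?X = ?X"
          using card_image[OF \<open>inj_on (\<lambda>x. x * t - g x) ?X\<close>] by (intro card_subset_eq) auto
      qed
      then have perm: "(\<Prod>x\<in>?X. x * t - g x) = (\<Prod>x\<in>?X. x)"
        by (rule prod.reindex_bij_betw)
      \<comment> \<open>Multiplying by the product of the nonzero elements, itself nonzero, clears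
        the denominators.\<close>
      have "poly H t * (\<Prod>x\<in>?X. x) = (\<Prod>x\<in>?X. (t - g x / x) * x)"
        unfolding poly_H by (rule prod.distrib[symmetric])
      also have "\<dots> = (\<Prod>x\<in>?X. x * t - g x)"
        by (rule prod.cong) (auto simp: field_simps)
      finally have "poly H t = 1" using perm by simp
      with False show ?thesis by (simp add: iff)
    qed
  qed
  have "Polynomial.order 0 H = card {x\<in>?X. g x / x = 0}"
    unfolding H_def by (rule order_prod_linear) simp
  \<comment> \<open>The removed element 0 is a zero of \<open>g\<close> and accounts for the
    \<open>- 1\<close>; the zeros of \<open>g\<close> are the scalars \<open>x\<close> with
    \<open>x v\<close> in \<open>U\<close>.\<close>
  also have "{x\<in>?X. g x / x = 0} = {x. g x = 0} - {0}" by auto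
  also have "card \<dots> = card {x. g x = 0} - 1"
    using g_0 by simp
  also have "card {x. g x = 0} = card (Fspan v \<inter> U)"
  proof -
    have "inj_on (\<lambda>x i. x * v i) {x. g x = 0}"
      using v(2) by (intro inj_onI) (metis (mono_tags, lifting) ext mult_right_cancel)
    moreover have "(\<lambda>x i. x * v i) ` {x. g x = 0} = Fspan v \<inter> U"
      using in_U_iff[of _ 0] by (auto simp: Fspan_def)
    ultimately show ?thesis using card_image by metis
  qed
  finally show ?thesis using deg val that by blast
qed

lemma card_point_inter_eq:
  assumes U: "Fq_subspace q r (U :: (nat \<Rightarrow> 'a) set)" "card U = q ^ (r*n - n)"
    and W: "Fq_subspace q r W" "card W = q ^ (r*n - n)"
    and r: "r \<ge> 2" and eq: "linset U = linset W"
    and v: "v \<in> vecspace r" "v \<noteq> (\<lambda>_. 0)"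
  shows "card (Fspan v \<inter> U) = card (Fspan v \<inter> W)"
proof -
  have same: "(\<exists>c. c \<noteq> 0 \<and> (\<lambda>i. c * w i) \<in> U) \<longleftrightarrow> (\<exists>c. c \<noteq> 0 \<and> (\<lambda>i. c * w i) \<in> W)"
    if "w \<noteq> (\<lambda>_. 0)" for w
    using Fspan_in_linset_iff[OF that] eq by metis
  obtain z where z: "z \<in> vecspace r" "z \<noteq> (\<lambda>_. 0)" "\<And>c. c \<noteq> 0 \<Longrightarrow> (\<lambda>i. c * z i) \<notin> U"
    using exists_outside[OF U r] by blast
  \<comment> \<open>One \<open>z\<close> serves both subspaces since the linear sets agree, so both
    polynomials belong to the same pencil \<open>v + t z\<close>.\<close>
  have z_W: "\<And>c. c \<noteq> 0 \<Longrightarrow> (\<lambda>i. c * z i) \<notin> W"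
    using same[OF z(2)] z(3) by blast
  have r1: "r \<ge> 1" using r by simp
  obtain H where H: "degree H < q ^ n"
    "\<forall>t. poly H t = (if \<exists>c. c \<noteq> 0 \<and> (\<lambda>i. c * (v i + t * z i)) \<in> U then 0 else 1)"
    "Polynomial.order 0 H = card (Fspan v \<inter> U) - 1"
    by (rule pencil_polynomial[OF U r1 z(1,3) v])
  obtain K where K: "degree K < q ^ n"
    "\<forall>t. poly K t = (if \<exists>c. c \<noteq> 0 \<and> (\<lambda>i. c * (v i + t * z i)) \<in> W then 0 else 1)"
    "Polynomial.order 0 K = card (Fspan v \<inter> W) - 1"
    by (rule pencil_polynomial[OF W r1 z(1) z_W v])
  have zero_in: "(\<lambda>_. 0) \<in> U" "(\<lambda>_. 0) \<in> W"
    using U(1) W(1) by (simp_all add: Fq_subspace_def)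
  have "poly H t = poly K t" for t
  \<comment> \<open>If \<open>z\<close> is proportional to \<open>v\<close>, some \<open>t\<close>
    gives the zero vector, which is no projective point; both values are then 0.\<close>
  proof (cases "(\<lambda>i. v i + t * z i) = (\<lambda>_. 0)")
    case True
    then have "(\<lambda>i. 1 * (v i + t * z i)) = (\<lambda>_. 0)" by simp
    then show ?thesis using zero_in H(2)[rule_format, of t] K(2)[rule_format, of t] by (metis one_neq_zero)
  next
    case False
    from same[OF this] show ?thesis by (simp only: H(2) K(2))
  qed
  then have "H = K"
    using H(1) K(1) by (intro poly_eqI_degree[of UNIV]) (simp_all add: card_field)
  then have "card (Fspan v \<inter> U) - 1 = card (Fspan v \<inter> W) - 1" using H(3) K(3) by simp
  \<comment> \<open>Both intersections contain 0, so the truncated subtraction of 1 can be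
    undone.\<close>
  moreover have "(\<lambda>_. 0) \<in> Fspan v" by (auto simp: Fspan_def intro: exI[of _ 0])
  then have "card (Fspan v \<inter> U) > 0" "card (Fspan v \<inter> W) > 0"
    using zero_in Fq_subspace_finite[OF U(1)] Fq_subspace_finite[OF W(1)]
    by (auto simp: card_gt_0_iff)
  ultimately show ?thesis by linarith
qed

lemma Fq_subspace_point_inter:
  assumes "Fq_subspace q r (U :: (nat \<Rightarrow> 'a) set)"
  shows "Fq_subspace q r (Fspan v \<inter> U)"
proof -
  have "(\<lambda>_. 0) \<in> Fspan v" by (auto simp: Fspan_def intro: exI[of _ 0])
  moreover have "(\<lambda>i. a i + b i) \<in> Fspan v" if "a \<in> Fspan v" "b \<in> Fspan v" for a b
    using that by (auto simp: Fspan_def distrib_right[symmetric])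
  moreover have "(\<lambda>i. c * a i) \<in> Fspan v" if "a \<in> Fspan v" for a c
    using that by (auto simp: Fspan_def mult.assoc[symmetric])
  ultimately show ?thesis using assms unfolding Fq_subspace_def by blast
qed

lemma weight_eq:
  assumes U: "Fq_subspace q r (U :: (nat \<Rightarrow> 'a) set)" "card U = q ^ (r*n - n)"
    and W: "Fq_subspace q r W" "card W = q ^ (r*n - n)"
    and r: "r \<ge> 2" and eq: "linset U = linset W" and P: "P \<in> linset U"
  shows "weight q U P = weight q W P"
proof -
  obtain u where u: "P = Fspan u" "u \<in> U" "u \<noteq> (\<lambda>_. 0)" using P by (auto simp: linset_def)
  then have "u \<in> vecspace r" using U(1) by (auto simp: Fq_subspace_def)
  from card_point_inter_eq[OF U W r eq this u(3)] show ?thesis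
    using Fq_dim_eq_iff_card_eq[OF Fq_subspace_point_inter[OF U(1)] Fq_subspace_point_inter[OF W(1)]]
    by (simp add: weight_def u(1))
qed

end

section \<open>The determinantal polynomial\<close>

lemma det_permute_rows_cols:
  fixes A :: "'a::comm_ring_1 mat"
  assumes A: "A \<in> carrier_mat N N" and \<rho>: "\<rho> permutes {0..<N}" and \<tau>: "\<tau> permutes {0..<N}"
  shows "det (mat N N (\<lambda>(i, j). A $$ (\<rho> i, \<tau> j))) = signof \<rho> * (signof \<tau> * det A)"
proof -
  have lt: "\<rho> i < N \<longleftrightarrow> i < N" "\<tau> i < N \<longleftrightarrow> i < N" for i
    using permutes_in_image[OF \<rho>, of i] permutes_in_image[OF \<tau>, of i] by auto
  let ?B = "mat N N (\<lambda>(i, j). A $$ (i, \<tau> j))"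
  have "mat N N (\<lambda>(i, j). A $$ (\<rho> i, \<tau> j)) = mat N N (\<lambda>(i, j). ?B $$ (\<rho> i, j))"
    by (intro eq_matI) (auto simp: lt)
  then have "det (mat N N (\<lambda>(i, j). A $$ (\<rho> i, \<tau> j))) = signof \<rho> * det ?B"
    using det_permute_rows[of ?B N \<rho>] \<rho> by simp
  also have "det ?B = det (transpose_mat ?B)"
    by (rule det_transpose[of _ N, symmetric]) simp
  also have "transpose_mat ?B = mat N N (\<lambda>(i, j). transpose_mat A $$ (\<tau> i, j))"
    using A by (intro eq_matI) (auto simp: lt)
  also have "det \<dots> = signof \<tau> * det (transpose_mat A)"
    by (rule det_permute_rows[OF _ \<tau>]) (use A in simp)
  also have "det (transpose_mat A) = det A" by (rule det_transpose[OF A])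
  finally show ?thesis .
qed

lemma sum_lessThan_add:
  "(\<Sum>a<l + m. f a) = (\<Sum>a<l. f a) + (\<Sum>i<m. f (l + i))" for f :: "nat \<Rightarrow> 'b::comm_monoid_add"
  by (induction m) (simp_all add: add.assoc)

text \<open>In the nonzero entries of the lower rows, \<open>b div r\<close> equals the row offset.
  With the exponent read off from the column, all entries of a column block carry the same Frobenius
  power.\<close>

definition det_matrix_at ::
    "nat \<Rightarrow> nat \<Rightarrow> nat \<Rightarrow> (nat \<Rightarrow> 'a::comm_ring_1) list \<Rightarrow> (nat \<Rightarrow> 'a) \<Rightarrow> 'a mat" where
  "det_matrix_at q n r us v = mat (r*n) (r*n) (\<lambda>(a, b).
     if a < r*n - n then ((us ! a) (b mod r)) ^ (q ^ (b div r))
     else (if b div r = a - (r*n - n) then v (b mod r) ^ (q ^ (b div r)) else 0))"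

lemma det_matrix_at_carrier: "det_matrix_at q n r us v \<in> carrier_mat (r*n) (r*n)"
  by (simp add: det_matrix_at_def)

lemma mpoly_eval_det_poly: "mpoly_eval v (det_poly q n r us) = det (det_matrix_at q n r us v)"
proof -
  have "map_mat (mpoly_eval v) (det_matrix q n r us) = det_matrix_at q n r us v"
    unfolding det_matrix_def det_matrix_at_def
    by (intro eq_matI) (auto simp: mpoly_eval.hom_power)
  then show ?thesis
    unfolding det_poly_def by (metis mpoly_eval.hom_det)
qed

text \<open>The upper rows are constant and the lower row \<open>i\<close> has degree at most
  \<open>q^i\<close>. The total is small enough for the \<open>(q - 1)\<close>-th power to have
  degree at most \<open>q^n - 1\<close> in each variable.\<close>

lemma var_degree_le_det_poly:
  assumes r: "r \<ge> 1"
  shows "var_degree_le t (if t < r then \<Sum>i<n. q ^ i else 0) (det_poly q n r us)"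
proof -
  let ?d = "\<lambda>a. if t < r then (if a < r*n - n then 0 else q ^ (a - (r*n - n))) else 0"
  have "var_degree_le t (?d a) (det_matrix q n r us $$ (a, b))" if "a < r*n" "b < r*n" for a b
  proof -
    have "var_degree_le t (if t < r then 1 else 0) (mvar (b mod r) :: 'a mpoly)"
      using r by (intro var_degree_le_mvar) auto
    from var_degree_le_power[OF this, of "q ^ (a - (r*n - n))"] show ?thesis
      using that by (auto simp: det_matrix_def split: if_splits)
  qed
  then have "var_degree_le t (\<Sum>a<r*n. ?d a) (det_poly q n r us)"
    unfolding det_poly_def by (intro var_degree_le_det) (simp_all add: det_matrix_def)
  also have "(\<Sum>a<r*n. ?d a) = (\<Sum>a<(r*n - n) + n. ?d a)"
    using r by simp
  also have "\<dots> = (if t < r then \<Sum>i<n. q ^ i else 0)"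
    unfolding sum_lessThan_add by (simp del: add_diff_assoc2 add: not_less)
  finally show ?thesis .
qed

context finite_field_extension
begin

text \<open>Frobenius carries column block \<open>j\<close> to block \<open>j + 1\<close> and lower
  row \<open>j\<close> to lower row \<open>j + 1\<close>, cyclically because
  \<open>x^(q^n) = x\<close>. The quantifier order matters: one \<open>s\<close> serves all bases
  and all points.\<close>

lemma det_matrix_at_power_q:
  assumes r: "r \<ge> 1"
  shows "\<exists>s. \<forall>us v. det (det_matrix_at q n r us v) ^ q = s * (det (det_matrix_at q n r us v) :: 'a)"
proof -
  define N where "N = r * n"
  define m where "m = r * n - n"
  have N: "N = m + n" using r by (simp add: N_def m_def)
  have r_N: "r \<le> N" using n_pos by (simp add: N_def)
  \<comment> \<open>\<open>\<rho>\<close> fixes the upper \<open>m\<close> rows and cycles the lower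
    \<open>n\<close>; \<open>\<tau>\<close> moves columns one block of length \<open>r\<close>
    further. Both are the identity from \<open>N\<close> on, as \<open>permutes\<close>
    demands.\<close>
  define \<rho> where "\<rho> a = (if a < m then a else if a + 1 < N then a + 1 else if a < N then m else a)" for a
  define \<tau> where "\<tau> b = (if b + r < N then b + r else if b < N then b + r - N else b)" for b
  have perm: "\<pi> permutes {0..<N}"
    if "inj_on \<pi> {0..<N}" "\<pi> ` {0..<N} \<subseteq> {0..<N}" "\<And>x. x \<ge> N \<Longrightarrow> \<pi> x = x" for \<pi> :: "nat \<Rightarrow> nat"
    by (rule bij_imp_permutes) (use that endo_inj_surj[of "{0..<N}" \<pi>] in \<open>auto simp: bij_betw_def\<close>)
  have \<rho>: "\<rho> permutes {0..<N}"
    by (rule perm) (use n_pos in \<open>auto simp: \<rho>_def N inj_on_def split: if_splits\<close>)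
  have \<tau>: "\<tau> permutes {0..<N}"
    by (rule perm) (use r_N r in \<open>auto simp: \<tau>_def inj_on_def split: if_splits\<close>)
  define next_idx where "next_idx j = (if j + 1 < n then j + 1 else 0)" for j
  have \<tau>_divmod: "\<tau> b div r = next_idx (b div r) \<and> \<tau> b mod r = b mod r" if "b < N" for b
  proof (cases "b + r < N")
    case True
    then have "(b + r) div r < n" by (simp add: N_def less_mult_imp_div_less mult.commute)
    with True r show ?thesis by (simp add: \<tau>_def next_idx_def)
  next
    case False
    \<comment> \<open>Here \<open>b\<close> lies in the last block, which wraps around to block
      0.\<close>
    obtain n' where n': "n = Suc n'" using n_pos by (cases n) auto
    then have "r * n' \<le> b" using False by (simp add: N_def)
    then obtain d where d: "b = r * n' + d" using le_Suc_ex by blast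
    have "d < r" using that by (simp add: d N_def n')
    then show ?thesis using False that r
      by (simp add: \<tau>_def next_idx_def d N_def n')
  qed
  have frob: "(x ^ (q ^ j)) ^ q = x ^ (q ^ next_idx j)" if "j < n" for j and x :: 'a
  proof -
    have "(x ^ (q ^ j)) ^ q = x ^ (q ^ Suc j)" by (simp add: power_mult[symmetric] mult.commute)
    moreover have "Suc j = n" if "\<not> j + 1 < n" using that \<open>j < n\<close> by simp
    ultimately show ?thesis using power_card_field[of x] by (auto simp: next_idx_def)
  qed
  have "det (det_matrix_at q n r us v) ^ q = (signof \<rho> * signof \<tau>) * (det (det_matrix_at q n r us v) :: 'a)"
    for us v
  proof -
    let ?M = "det_matrix_at q n r us v"
    interpret frobenius: comm_ring_hom "\<lambda>x::'a. x ^ q" by (rule frobenius_hom)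
    have "map_mat (\<lambda>x. x ^ q) ?M = mat N N (\<lambda>(a, b). ?M $$ (\<rho> a, \<tau> b))"
    proof (rule eq_matI)
      fix a b assume "a < dim_row (mat N N (\<lambda>(a, b). ?M $$ (\<rho> a, \<tau> b)))"
        "b < dim_col (mat N N (\<lambda>(a, b). ?M $$ (\<rho> a, \<tau> b)))"
      then have ab: "a < N" "b < N" by simp_all
      have lt: "\<rho> a < N" "\<tau> b < N"
        using permutes_in_image[OF \<rho>, of a] permutes_in_image[OF \<tau>, of b] ab by auto
      have j: "b div r < n" using ab(2) by (simp add: N_def less_mult_imp_div_less mult.commute)
      have M: "?M $$ (a, b) = (if a < m then ((us ! a) (b mod r)) ^ (q ^ (b div r))
          else (if b div r = a - m then v (b mod r) ^ (q ^ (b div r)) else 0))"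
        if "a < N" "b < N" for a b
        using that by (simp add: det_matrix_at_def N_def m_def)
      have "(?M $$ (a, b)) ^ q = ?M $$ (\<rho> a, \<tau> b)"
      proof (cases "a < m")
        case True
        then have "\<rho> a = a" by (simp add: \<rho>_def)
        then show ?thesis
          using True ab lt \<tau>_divmod[OF ab(2)] by (simp add: M frob[OF j])
      next
        case False
        then have \<rho>_a: "\<not> \<rho> a < m" "\<rho> a - m = next_idx (a - m)"
          using ab by (auto simp: \<rho>_def next_idx_def N)
        \<comment> \<open>\<open>next_idx\<close> is injective below \<open>n\<close>, so the zero
          blocks of the lower rows are moved to zero blocks.\<close>
        have "next_idx (b div r) = next_idx (a - m) \<longleftrightarrow> b div r = a - m"
          using j False ab by (auto simp: next_idx_def N split: if_splits)
        then show ?thesis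
          using False \<rho>_a ab lt \<tau>_divmod[OF ab(2)] q_ge_2 frob[OF j, of "v (b mod r)"] by (auto simp: M)
      qed
      then show "map_mat (\<lambda>x. x ^ q) ?M $$ (a, b) = mat N N (\<lambda>(a, b). ?M $$ (\<rho> a, \<tau> b)) $$ (a, b)"
        using ab by (simp add: det_matrix_at_def N_def)
    qed (simp_all add: det_matrix_at_def N_def)
    then have "det ?M ^ q = det (mat N N (\<lambda>(a, b). ?M $$ (\<rho> a, \<tau> b)))"
      by (metis frobenius.hom_det)
    also have "\<dots> = signof \<rho> * (signof \<tau> * det ?M)"
      by (rule det_permute_rows_cols[OF _ \<rho> \<tau>]) (simp add: N_def det_matrix_at_carrier)
    finally show ?thesis by (simp add: mult.assoc)
  qed
  then show ?thesis by blast
qed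

text \<open>Write \<open>c v\<close> in the basis and raise to the power \<open>q^j\<close>: the
  coordinates, lying in the subfield, stay fixed while \<open>c\<close> becomes
  \<open>c^(q^j)\<close>. For all \<open>j\<close> together this is one linear relation among the
  rows, with coefficients \<open>y\<close>.\<close>

lemma det_matrix_at_eq_0I:
  assumes basis: "Fq_basis q U us" and len: "length us = r*n - n" and r: "r \<ge> 1"
    and c: "c \<noteq> 0" "(\<lambda>i. c * v i :: 'a) \<in> U"
  shows "det (det_matrix_at q n r us v) = 0"
proof -
  define N where "N = r * n"
  define m where "m = r * n - n"
  have N: "N = m + n" using r by (simp add: N_def m_def)
  let ?M = "det_matrix_at q n r us v"
  have M: "?M \<in> carrier_mat N N" by (simp add: N_def det_matrix_at_carrier)
  obtain cs where cs: "length cs = m" "set cs \<subseteq> Fq q" "(\<lambda>i. c * v i) = Fq_lincomb us cs"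
    using basis c(2) len unfolding Fq_basis_def m_def by metis
  have comb: "(\<Sum>a<m. cs ! a * (us ! a) i) = c * v i" for i
    using fun_cong[OF cs(3), of i] len by (simp add: Fq_lincomb_def m_def)
  define y where "y = vec N (\<lambda>a. if a < m then cs ! a else - (c ^ (q ^ (a - m))))"
  \<comment> \<open>The first lower row has coefficient \<open>- (c^(q^0))\<close>, so the relation
    is nontrivial.\<close>
  have "y $ m = - c" using n_pos by (simp add: y_def N)
  then have "y \<noteq> 0\<^sub>v N" using c(1) n_pos by (auto simp: N)
  moreover have "transpose_mat ?M *\<^sub>v y = 0\<^sub>v N"
  proof (rule eq_vecI)
    fix b assume "b < dim_vec (0\<^sub>v N :: 'a vec)"
    then have b: "b < N" by simp
    define j where "j = b div r"
    have j: "j < n" using b by (simp add: j_def N_def less_mult_imp_div_less mult.commute)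
    have entry: "?M $$ (a, b) = (if a < m then ((us ! a) (b mod r)) ^ (q ^ j)
          else (if j = a - m then v (b mod r) ^ (q ^ j) else 0))" if "a < N" for a
      using that b by (simp add: det_matrix_at_def N_def m_def j_def)
    have "(transpose_mat ?M *\<^sub>v y) $ b = (\<Sum>a<N. ?M $$ (a, b) * y $ a)"
      using M b by (simp add: scalar_prod_def y_def atLeast0LessThan)
    also have "\<dots> = (\<Sum>a<m. ?M $$ (a, b) * y $ a) + (\<Sum>i<n. ?M $$ (m + i, b) * y $ (m + i))"
      unfolding N by (rule sum_lessThan_add)
    also have "(\<Sum>a<m. ?M $$ (a, b) * y $ a) = (\<Sum>a<m. (cs ! a * (us ! a) (b mod r)) ^ (q ^ j))"
    proof (rule sum.cong)
      fix a assume "a \<in> {..<m}"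
      moreover from this have "(cs ! a) ^ (q ^ j) = cs ! a"
        using cs(1,2) by (intro Fq_power_q_power) auto
      ultimately show "?M $$ (a, b) * y $ a = (cs ! a * (us ! a) (b mod r)) ^ (q ^ j)"
        by (simp add: entry y_def N power_mult_distrib mult.commute)
    qed simp
    also have "\<dots> = (c * v (b mod r)) ^ (q ^ j)"
      unfolding frobenius_sum[symmetric] comb ..
    also have "(\<Sum>i<n. ?M $$ (m + i, b) * y $ (m + i)) =
        (\<Sum>i<n. if j = i then - ((c * v (b mod r)) ^ (q ^ j)) else 0)"
      by (rule sum.cong) (auto simp: entry y_def N power_mult_distrib mult.commute)
    also have "\<dots> = - ((c * v (b mod r)) ^ (q ^ j))" using j by simp
    finally show "(transpose_mat ?M *\<^sub>v y) $ b = 0\<^sub>v N $ b" using b by simp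
  qed (use M in simp)
  moreover have "y \<in> carrier_vec N" by (simp add: y_def)
  ultimately have "det (transpose_mat ?M) = 0"
    using det_0_iff_vec_prod_zero_field[of "transpose_mat ?M" N] M by auto
  then show ?thesis using det_transpose[OF M] by simp
qed

text \<open>A column relation of the matrix is a linearized polynomial map that vanishes on \<open>U\<close> and on
  \<open>\<langle>v\<rangle>\<close>. If these two spaces span \<open>V\<close>, all its coefficients are zero.\<close>

lemma det_matrix_at_eq_0D:
  assumes U: "Fq_subspace q r U" and basis: "Fq_basis q U us" and len: "length us = r*n - n"
    and r: "r \<ge> 1" and v: "v \<in> vecspace r" and det0: "det (det_matrix_at q n r us v) = 0"
  shows "\<exists>c. c \<noteq> 0 \<and> (\<lambda>i. c * v i :: 'a) \<in> U"
proof (rule ccontr)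
  assume no: "\<not> (\<exists>c. c \<noteq> 0 \<and> (\<lambda>i. c * v i) \<in> U)"
  define N where "N = r * n"
  define m where "m = r * n - n"
  have N: "N = m + n" using r by (simp add: N_def m_def)
  let ?M = "det_matrix_at q n r us v"
  have M: "?M \<in> carrier_mat N N" by (simp add: N_def det_matrix_at_carrier)
  obtain y where y: "y \<in> carrier_vec N" "y \<noteq> 0\<^sub>v N" "?M *\<^sub>v y = 0\<^sub>v N"
    using det0 det_0_iff_vec_prod_zero_field[OF M] by blast
  have row: "(\<Sum>b<N. ?M $$ (a, b) * y $ b) = 0" if "a < N" for a
  proof -
    have "(?M *\<^sub>v y) $ a = (\<Sum>b<N. ?M $$ (a, b) * y $ b)"
      using M y(1) that by (simp add: scalar_prod_def atLeast0LessThan)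
    then show ?thesis using y(3) that by simp
  qed
  have div_lt: "b div r < n" if "b < N" for b
    using that by (simp add: N_def less_mult_imp_div_less mult.commute)
  \<comment> \<open>The kernel vector \<open>y\<close> becomes the coefficient vector of a
    linearized map; the upper rows say that it vanishes on \<open>us\<close>.\<close>
  define \<phi> where "\<phi> w = (\<Sum>b<N. w (b mod r) ^ (q ^ (b div r)) * y $ b)" for w :: "nat \<Rightarrow> 'a"
  have \<phi>_add: "\<phi> (\<lambda>i. u i + w i) = \<phi> u + \<phi> w" for u w
    by (simp add: \<phi>_def frobenius_add distrib_right sum.distrib)
  have \<phi>_us: "\<phi> (us ! a) = 0" if "a < m" for a
    using row[of a] that unfolding \<phi>_def by (simp add: N det_matrix_at_def N_def[symmetric] m_def[symmetric])
  have \<phi>_U: "\<phi> u = 0" if u: "u \<in> U" for u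
  proof -
    obtain cs where cs: "length cs = m" "set cs \<subseteq> Fq q" "u = Fq_lincomb us cs"
      using basis u len unfolding Fq_basis_def m_def by metis
    have "u i ^ (q ^ j) = (\<Sum>a<m. cs ! a * (us ! a) i ^ (q ^ j))" for i j
    proof -
      have "u i ^ (q ^ j) = (\<Sum>a<m. (cs ! a * (us ! a) i) ^ (q ^ j))"
        unfolding cs(3) Fq_lincomb_def len m_def by (rule frobenius_sum)
      also have "\<dots> = (\<Sum>a<m. cs ! a * (us ! a) i ^ (q ^ j))"
        using cs(1,2) by (intro sum.cong) (auto simp: power_mult_distrib Fq_power_q_power[OF subsetD, OF _ nth_mem])
      finally show ?thesis .
    qed
    then have "\<phi> u = (\<Sum>b<N. \<Sum>a<m. cs ! a * ((us ! a) (b mod r) ^ (q ^ (b div r)) * y $ b))"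
      by (simp add: \<phi>_def sum_distrib_right mult.assoc)
    also have "\<dots> = (\<Sum>a<m. cs ! a * \<phi> (us ! a))"
      by (subst sum.swap) (simp add: \<phi>_def sum_distrib_left)
    finally show ?thesis by (simp add: \<phi>_us)
  qed
  \<comment> \<open>The lower rows make the contribution of each block vanish separately, so
    multiplying block \<open>j\<close> by \<open>c^(q^j)\<close> does no harm. Linearity over the
    subfield would cover only \<open>c\<close> in that subfield.\<close>
  have \<phi>_v: "\<phi> (\<lambda>i. c * v i) = 0" for c
  proof -
    have "\<phi> (\<lambda>i. c * v i) = (\<Sum>j<n. \<Sum>b\<in>{b\<in>{..<N}. b div r = j}. (c * v (b mod r)) ^ (q ^ (b div r)) * y $ b)"
      unfolding \<phi>_def by (rule sum.group[symmetric]) (use div_lt in auto)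
    also have "\<dots> = (\<Sum>j<n. c ^ (q ^ j) * (\<Sum>b<N. ?M $$ (m + j, b) * y $ b))"
    proof (rule sum.cong)
      fix j assume "j \<in> {..<n}"
      then have "(\<Sum>b<N. ?M $$ (m + j, b) * y $ b) =
          (\<Sum>b<N. if b div r = j then v (b mod r) ^ (q ^ j) * y $ b else 0)"
        by (intro sum.cong) (auto simp: det_matrix_at_def N_def[symmetric] m_def[symmetric] N)
      also have "\<dots> = (\<Sum>b\<in>{b\<in>{..<N}. b div r = j}. v (b mod r) ^ (q ^ j) * y $ b)"
        by (rule sum.inter_filter[symmetric]) simp
      finally show "(\<Sum>b\<in>{b\<in>{..<N}. b div r = j}. (c * v (b mod r)) ^ (q ^ (b div r)) * y $ b) =
          c ^ (q ^ j) * (\<Sum>b<N. ?M $$ (m + j, b) * y $ b)"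
        by (simp add: sum_distrib_left power_mult_distrib mult.assoc)
    qed simp
    also have "\<dots> = 0" using row by (simp add: N)
    finally show ?thesis .
  qed
  have \<phi>_all: "\<phi> w = 0" if w: "w \<in> vecspace r" for w
  proof -
    have out: "\<And>c. c \<noteq> 0 \<Longrightarrow> (\<lambda>i. c * v i) \<notin> U" using no by blast
    have card_U: "card U = q ^ (r*n - n)" using card_eq_of_Fq_basis[OF U basis] len by simp
    obtain u c where "u \<in> U" "w = (\<lambda>i. u i + c * v i)"
      by (rule complement_decomposition[OF U card_U r v out w])
    then show ?thesis using \<phi>_add[of u "\<lambda>i. c * v i"] \<phi>_U \<phi>_v by simp
  qed
  have "y $ b0 = 0" if b0: "b0 < N" for b0
  proof -
    \<comment> \<open>On vectors supported in the coordinate \<open>b0 mod r\<close>,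
      \<open>\<phi>\<close> is a polynomial in the entry \<open>x\<close> with exponents
      \<open>q^j < q^n\<close>, hence determined by its values.\<close>
    define B where "B = {b\<in>{..<N}. b mod r = b0 mod r}"
    have lt: "q ^ (b div r) < card (UNIV :: 'a set)" if "b < N" for b
      unfolding card_field using div_lt[OF that] q_ge_2 by (intro power_strict_increasing) auto
    have "(\<Sum>j<card (UNIV :: 'a set). (\<Sum>b\<in>{b\<in>B. q ^ (b div r) = j}. y $ b) * x ^ j) = 0" for x :: 'a
    proof -
      have "(\<Sum>j<card (UNIV :: 'a set). (\<Sum>b\<in>{b\<in>B. q ^ (b div r) = j}. y $ b) * x ^ j) =
          (\<Sum>j<card (UNIV :: 'a set). \<Sum>b\<in>{b\<in>B. q ^ (b div r) = j}. y $ b * x ^ (q ^ (b div r)))"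
        by (simp add: sum_distrib_right)
      also have "\<dots> = (\<Sum>b\<in>B. y $ b * x ^ (q ^ (b div r)))"
        by (rule sum.group) (use lt in \<open>auto simp: B_def\<close>)
      also have "\<dots> = (\<Sum>b<N. if b mod r = b0 mod r then y $ b * x ^ (q ^ (b div r)) else 0)"
        unfolding B_def by (rule sum.inter_filter) simp
      also have "\<dots> = \<phi> (\<lambda>i. if i = b0 mod r then x else 0)"
        unfolding \<phi>_def using q_ge_2 by (intro sum.cong) (auto simp: mult.commute)
      also have "\<dots> = 0"
        using r by (intro \<phi>_all) (simp add: vecspace_def, metis mod_less_divisor less_eq_Suc_le not_less One_nat_def)
      finally show ?thesis .
    qed
    from reduced_univariate_zero[OF this lt[OF b0]]
    have "(\<Sum>b\<in>{b\<in>B. q ^ (b div r) = q ^ (b0 div r)}. y $ b) = 0" .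
    \<comment> \<open>Residue and block index determine the column, so the coefficient sum has the
      single term \<open>y $ b0\<close>.\<close>
    moreover have "{b\<in>B. q ^ (b div r) = q ^ (b0 div r)} = {b0}"
    proof -
      have "b = b0" if "b mod r = b0 mod r" "q ^ (b div r) = q ^ (b0 div r)" for b
      proof -
        have "b div r = b0 div r" using that(2) q_ge_2 by simp
        with that(1) show ?thesis by (metis div_mult_mod_eq)
      qed
      then show ?thesis using b0 by (auto simp: B_def)
    qed
    ultimately show ?thesis by simp
  qed
  then have "y = 0\<^sub>v N" using y(1) by (intro eq_vecI) auto
  with y(2) show False by simp
qed

lemma det_poly_proportional:
  assumes U: "Fq_subspace q r (U :: (nat \<Rightarrow> 'a) set)" "Fq_basis q U us" "length us = r*n - n"
    and W: "Fq_subspace q r W" "Fq_basis q W ws" "length ws = r*n - n"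
    and r: "r \<ge> 2" and eq: "linset U = linset W"
  shows "\<exists>c. c \<noteq> 0 \<and> det_poly q n r ws = mconst c * det_poly q n r us"
proof -
  have r1: "r \<ge> 1" using r by simp
  let ?F = "det_poly q n r us" and ?G = "det_poly q n r ws"
  obtain s :: 'a where "\<forall>us v. det (det_matrix_at q n r us v) ^ q = s * det (det_matrix_at q n r us v)"
    using det_matrix_at_power_q[OF r1] by blast
  then have s: "mpoly_eval v (det_poly q n r us) ^ q = s * mpoly_eval v (det_poly q n r us)" for v us
    by (simp add: mpoly_eval_det_poly)
  have power_eq: "mpoly_eval v (det_poly q n r us) ^ (q - 1) = s"
    if "mpoly_eval v (det_poly q n r us) \<noteq> 0" for v us
  proof -
    have "q = Suc (q - 1)" using q_ge_2 by simp
    then have "mpoly_eval v (det_poly q n r us) * mpoly_eval v (det_poly q n r us) ^ (q - 1) =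
        mpoly_eval v (det_poly q n r us) * s"
      using s[of v us] by (metis mult.commute power_Suc)
    with that show ?thesis by simp
  qed
  have zero_iff_U: "mpoly_eval v ?F = 0 \<longleftrightarrow> (\<exists>c. c \<noteq> 0 \<and> (\<lambda>i. c * v i) \<in> U)" if "v \<in> vecspace r" for v
    unfolding mpoly_eval_det_poly
    using det_matrix_at_eq_0D[OF U r1 that] det_matrix_at_eq_0I[OF U(2,3) r1] by blast
  have zero_iff_W: "mpoly_eval v ?G = 0 \<longleftrightarrow> (\<exists>c. c \<noteq> 0 \<and> (\<lambda>i. c * v i) \<in> W)" if "v \<in> vecspace r" for v
    unfolding mpoly_eval_det_poly
    using det_matrix_at_eq_0D[OF W r1 that] det_matrix_at_eq_0I[OF W(2,3) r1] by blast
  have zero_iff: "mpoly_eval v ?F = 0 \<longleftrightarrow> mpoly_eval v ?G = 0" if v: "v \<in> vecspace r" for v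
  \<comment> \<open>The zero vector spans no point, but lies in \<open>U\<close> and
    \<open>W\<close>, so both polynomials vanish there.\<close>
  proof (cases "v = (\<lambda>_. 0)")
    case True
    have "(\<lambda>i. 1 * v i) \<in> U" "(\<lambda>i. 1 * v i) \<in> W"
      using True U(1) W(1) by (simp_all add: Fq_subspace_def)
    then show ?thesis using zero_iff_U[OF v] zero_iff_W[OF v] by (metis one_neq_zero)
  next
    case False
    then show ?thesis
      using zero_iff_U[OF v] zero_iff_W[OF v] Fspan_in_linset_iff[OF False] eq by metis
  qed
  have "?F ^ (q - 1) - ?G ^ (q - 1) = 0"
  proof (rule reduced_mpoly_zero)
    have deg: "var_degree_le t (if t < r then card (UNIV :: 'a set) - 1 else 0) (det_poly q n r us ^ (q - 1))"
      for t and us :: "(nat \<Rightarrow> 'a) list"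
    proof -
      have "(q - 1) * (\<Sum>i<n. q ^ i) = card (UNIV :: 'a set) - 1"
        using geometric_sum_q[of n] by (simp add: card_field)
      then show ?thesis
        using var_degree_le_power[OF var_degree_le_det_poly[OF r1, of t q n us], of "q - 1"]
        by (auto split: if_splits)
    qed
    show "var_degree_le t (card (UNIV :: 'a set) - 1) (?F ^ (q - 1) - ?G ^ (q - 1))" if "t < r" for t
      using deg[of t us] deg[of t ws] that by (simp add: var_degree_le_diff)
    show "var_degree_le t 0 (?F ^ (q - 1) - ?G ^ (q - 1))" if "t \<ge> r" for t
      using deg[of t us] deg[of t ws] that by (simp add: var_degree_le_diff)
    show "mpoly_eval v (?F ^ (q - 1) - ?G ^ (q - 1)) = 0" if "v \<in> vecspace r" for v
      using zero_iff[OF that] power_eq[of v us] power_eq[of v ws]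
      by (cases "mpoly_eval v ?F = 0") (simp_all add: mpoly_eval.hom_minus mpoly_eval.hom_power)
  qed
  then have powers: "?F ^ (q - 1) = ?G ^ (q - 1)" by simp
  have card_U: "card U = q ^ (r*n - n)" using card_eq_of_Fq_basis[OF U(1,2)] U(3) by simp
  obtain z where z: "z \<in> vecspace r" "\<And>c. c \<noteq> 0 \<Longrightarrow> (\<lambda>i. c * z i) \<notin> U"
    using exists_outside[OF U(1) card_U r] by metis
  let ?a = "mpoly_eval z ?F" and ?b = "mpoly_eval z ?G"
  have "?a \<noteq> 0" using zero_iff_U[OF z(1)] z(2) by blast
  moreover from this have "?b \<noteq> 0" using zero_iff[OF z(1)] by simp
  ultimately have nz: "?a \<noteq> 0" "?b \<noteq> 0" .
  \<comment> \<open>Evaluation at \<open>z\<close> forces this choice. Both values there have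
    \<open>(q - 1)\<close>-th power \<open>s\<close>, hence \<open>c^(q - 1) = 1\<close>, and the
    difference of powers can be factored.\<close>
  define c where "c = ?b / ?a"
  have "c \<noteq> 0" using nz by (simp add: c_def)
  have "s \<noteq> 0" using power_eq[OF nz(1)] nz(1) by auto
  then have "c ^ (q - 1) = 1"
    using power_eq[OF nz(1)] power_eq[OF nz(2)] by (simp add: c_def power_divide)
  moreover have "mconst c ^ l = mconst (c ^ l)" for l
    by (induction l) (simp_all add: mconst_def mult_single)
  ultimately have "(mconst c * ?F) ^ (q - 1) = ?G ^ (q - 1)"
    using powers by (simp add: power_mult_distrib mconst_def)
  then have "(?G - mconst c * ?F) * (\<Sum>i<q - 1. (mconst c * ?F) ^ (q - 1 - Suc i) * ?G ^ i) = 0"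
    using power_diff_sumr2[of ?G "q - 1" "mconst c * ?F"] by simp
  moreover have "(\<Sum>i<q - 1. (mconst c * ?F) ^ (q - 1 - Suc i) * ?G ^ i) \<noteq> 0" (is "?S \<noteq> 0")
  proof -
    have "c * ?a = ?b" using nz by (simp add: c_def)
    then have "mpoly_eval z ?S = (\<Sum>i<q - 1. ?b ^ (q - 1 - Suc i) * ?b ^ i)"
      by (simp add: mpoly_eval.hom_sum mpoly_eval.hom_mult mpoly_eval.hom_power)
    also have "\<dots> = (\<Sum>i<q - 1. ?b ^ (q - 2))"
      by (intro sum.cong) (simp_all add: power_add[symmetric])
    \<comment> \<open>\<open>q = 0\<close> in the field, so \<open>q - 1\<close> equal summands add
      up to minus one of them; hence the cofactor is nonzero.\<close>
    also have "\<dots> = - (?b ^ (q - 2))"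
      using q_ge_2 of_nat_q by (simp add: of_nat_diff)
    finally have "mpoly_eval z ?S \<noteq> 0" using nz by simp
    then show ?thesis by auto
  qed
  ultimately have "?G = mconst c * ?F" by simp
  with \<open>c \<noteq> 0\<close> show ?thesis by blast
qed

end

theorem mainTheorem4:
  fixes U W :: "(nat \<Rightarrow> 'a::{field,finite}) set"
    and us ws :: "(nat \<Rightarrow> 'a) list"
    and p k q n r :: nat
  assumes "prime p" and "k \<ge> 1" and "q = p ^ k"
    and "n \<ge> 2" and "r \<ge> 2"
    and "card (UNIV :: 'a set) = q ^ n"
    and "Fq_subspace q r U" and "Fq_subspace q r W"
    and "Fq_basis q U us" and "length us = r*n - n"
    and "Fq_basis q W ws" and "length ws = r*n - n"
    and "linset U = linset W"
  shows "(\<exists>c::'a. c \<noteq> 0 \<and> det_poly q n r ws = mconst c * det_poly q n r us)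
       \<and> (\<forall>P\<in>linset U. weight q U P = weight q W P)"
proof -
  interpret finite_field_extension "TYPE('a)" p k q n
    using assms by unfold_locales auto
  have "card U = q ^ (r*n - n)" "card W = q ^ (r*n - n)"
    using card_eq_of_Fq_basis assms by metis+
  then show ?thesis
    using det_poly_proportional[OF assms(7,9,10,8,11,12,5,13)] weight_eq assms by blast
qed

end
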